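(* Let $d\ge 1$, let $0<a_i<\infty$ for $i=1,\dots,d$, and let $Q=(-a_1,a_1)\times\cdots\times(-a_d,a_d)\subset\mathbb{R}^d$. Let $0<\alpha\le 2$, let $X_t^{\alpha}$ be the $d$-dimensional symmetric stable process of index $\alpha$, let $n\ge 1$ and let $0<t_1<t_2<\dots<t_n<\infty$. Then the function $$F(x)=P_x\{X_{t_1}^{\alpha}\in Q,\dots,X_{t_n}^{\alpha}\in Q\}$$ is mid-concave in $Q$. In addition, for every $x=(x_1,\dots,x_d)\in Q$ and every $i\in\{1,\dots,d\}$, $$\frac{\partial}{\partial x_i}F(x)\ge 0\ \text{ if } x_i<0,\qquad \frac{\partial}{\partial x_i}F(x)\le 0\ \text{ if } x_i>0.$$
   Context: Symmetric stable process: for $0<\alpha\le 2$, $X_t^{\alpha}$ is the $d$-dimensional Lévy process (stationary independent increments, right-continuous sample paths) with transition density $p_t^{\alpha}(x,y)=p_t^{\alpha}(x-y)$, $t>0$, $x,y\in\mathbb{R}^d$, determined by $\int_{\mathbb{R}^d}e^{i\xi\cdot y}p_t^{\alpha}(y)\,dy=\exp(-t|\xi|^{\alpha})$. (For $\alpha=2$ this is Brownian motion running at twice the standard speed.) $P_x$ denotes probability for the process started at $x$. Mid-concavity: let $D\subset\mathbb{R}^d$ be a convex domain symmetric relative to each coordinate axis (i.e. invariant under changing the sign of any single coordinate). Let $J$ be a line segment in $D$ parallel to the $x_1$-axis which intersects $\partial D$ only at the two points $(-a_1,a_2,\dots,a_d)$ and $(a_1,a_2,\dots,a_d)$, $a_1>0$.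 A function $F:D\to\mathbb{R}$ is mid-concave on $J$ if it is concave on the segment from $(-a_1/2,a_2,\dots,a_d)$ to $(a_1/2,a_2,\dots,a_d)$. $F$ is mid-concave along the $x_1$-axis if it is mid-concave on every such segment parallel to the $x_1$-axis; mid-concavity along the $x_2$-axis, ..., $x_d$-axis is defined similarly. $F$ is mid-concave on $D$ if it is mid-concave along each coordinate axis. *)

theory Defs
  imports "HOL-Probability.Probability"
begin

definition set_coord :: "real^'n \<Rightarrow> 'n::finite \<Rightarrow> real \<Rightarrow> real^'n" where
  "set_coord x i c = (\<chi> j. if j = i then c else x $ j)"

text \<open>Time is indexed by the reals, but only times in \<open>[0, \<infinity>)\<close> matter.\<close>

definition levy_process ::
    "'w measure \<Rightarrow> (real \<Rightarrow> 'w \<Rightarrow> real^'n::finite) \<Rightarrow> bool" where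
  "levy_process M X \<longleftrightarrow>
     prob_space M \<and>
     (\<forall>t\<ge>0. X t \<in> borel_measurable M) \<and>
     (\<forall>(m::nat) s. 0 \<le> s 0 \<and> (\<forall>k<m. s k < s (Suc k)) \<longrightarrow>
        prob_space.indep_vars M (\<lambda>_. borel) (\<lambda>k \<omega>. X (s (Suc k)) \<omega> - X (s k) \<omega>) {..<m}) \<and>
     (\<forall>s\<ge>0. \<forall>h\<ge>0. distr M borel (\<lambda>\<omega>. X (s + h) \<omega> - X s \<omega>) =
                    distr M borel (\<lambda>\<omega>. X h \<omega> - X 0 \<omega>)) \<and>
     (\<forall>\<omega>\<in>space M. \<forall>t\<ge>0. continuous (at_right t) (\<lambda>s. X s \<omega>))"

text \<open>The Fourier transform determines the density only up to null sets, so this is a predicate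
  and not a function. Nonnegativity is required as \<open>p t\<close> is converted to an extended
  nonnegative real in \<open>symmetric_stable_process\<close>.\<close>

definition stable_density :: "real \<Rightarrow> (real \<Rightarrow> real^'n::finite \<Rightarrow> real) \<Rightarrow> bool" where
  "stable_density \<alpha> p \<longleftrightarrow>
     (\<forall>t>0. (\<forall>y. 0 \<le> p t y) \<and> integrable lborel (p t) \<and>
        (\<forall>\<xi>. (\<integral>y. iexp (\<xi> \<bullet> y) * complex_of_real (p t y) \<partial>lborel) =
              complex_of_real (exp (- t * norm \<xi> powr \<alpha>))))"

text \<open>\<open>P x\<close> is the law under which the process starts at \<open>x\<close>;
  the transition density is \<open>p\<^sub>t(x, y) = p\<^sub>t(x - y)\<close>.\<close>

definition symmetric_stable_process ::
    "real \<Rightarrow> (real^'n::finite \<Rightarrow> 'w measure) \<Rightarrow> (real \<Rightarrow> 'w \<Rightarrow> real^'n) \<Rightarrow> bool" where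
  "symmetric_stable_process \<alpha> P X \<longleftrightarrow>
     (\<forall>x. levy_process (P x) X \<and> (AE \<omega> in P x. X 0 \<omega> = x)) \<and>
     (\<exists>p. stable_density \<alpha> p \<and>
        (\<forall>x. \<forall>t>0. distributed (P x) lborel (X t) (\<lambda>y. ennreal (p t (x - y)))))"

definition coord_symmetric_convex_domain :: "(real^'n::finite) set \<Rightarrow> bool" where
  "coord_symmetric_convex_domain D \<longleftrightarrow>
     open D \<and> D \<noteq> {} \<and> convex D \<and> (\<forall>i. \<forall>x\<in>D. set_coord x i (- x $ i) \<in> D)"

text \<open>A segment \<open>J\<close> parallel to the \<open>i\<close>-th axis is represented by its endpoint \<open>q\<close> with
  positive \<open>i\<close>-th coordinate. As \<open>D\<close> is open, the endpoints lie on the frontier and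
  only the open segment is contained in \<open>D\<close>.\<close>

definition mid_concave_along ::
    "'n::finite \<Rightarrow> (real^'n) set \<Rightarrow> (real^'n \<Rightarrow> real) \<Rightarrow> bool" where
  "mid_concave_along i D F \<longleftrightarrow>
     (\<forall>q. 0 < q $ i \<and>
          open_segment (set_coord q i (- q $ i)) q \<subseteq> D \<and>
          closed_segment (set_coord q i (- q $ i)) q \<inter> frontier D = {set_coord q i (- q $ i), q} \<longrightarrow>
        concave_on (closed_segment (set_coord q i (- q $ i / 2)) (set_coord q i (q $ i / 2))) F)"

definition mid_concave :: "(real^'n::finite) set \<Rightarrow> (real^'n \<Rightarrow> real) \<Rightarrow> bool" where
  "mid_concave D F \<longleftrightarrow> coord_symmetric_convex_domain D \<and> (\<forall>i. mid_concave_along i D F)"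

end

theory Submission
  imports Defs
begin

text \<open>By independence of increments, \<open>F\<close> arises from the constant 1 by applying, once for each time,
an operator \<open>f \<mapsto> (\<lambda>x. \<integral>\<^sub>Q q(x - y) f(y) dy)\<close>, where \<open>q\<close> is the transition density of the process over the
elapsed time. It therefore suffices to find a class of functions on \<open>Q\<close> that contains 1, is preserved by these
operators, and consists of functions that are concave and unimodal along the coordinate axes in the
required sense.

Subordination reduces the question to Gaussian densities. The function \<open>l \<mapsto> exp (-t l\<^sup>\<beta>)\<close>,
\<open>\<beta> = \<alpha>/2 \<le> 1\<close>, is a limit of nonnegative combinations of functions \<open>exp (-s l)\<close>
(\<open>laplace_mixture_exp_powr\<close>). With \<open>l = |\<xi>|\<^sup>2\<close> and the inverse Fourier transform this exhibits the stable
density as a limit of nonnegative combinations of centred Gaussian densities. The class in question,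
\<open>mid_cone\<close>, is a convex cone that is closed under bounded pointwise limits, so only
Gaussian kernels have to be examined, and by linearity only functions that generate the cone. These generators are
products of functions of one coordinate each, and as a Gaussian density is such a product as well, the
operator acts on each factor separately.

What remains is the heart of the matter, a statement about functions \<open>f\<close> of one variable on
\<open>(-a, a)\<close> (\<open>axis_profile_convolution\<close>). Concavity of \<open>f\<close> on \<open>[-a/2, a/2]\<close> alone need not survive convolution with a
Gaussian: if \<open>f\<close> were steep just inside \<open>a/2\<close> and flat beyond it, smoothing would put an inflection point
inside. The invariant property is that \<open>f\<close> is even, nonnegative and decreasing on \<open>[0, a]\<close>, concave on \<open>[0, a/2]\<close>, and falls
at \<open>a - x\<close> at least as steeply as at \<open>x\<close>, for \<open>x \<le> a/2\<close>. Folding the convolution integral at 0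
and again at \<open>a/2\<close> shows that these conditions together are preserved by every smooth, even,
nonnegative kernel that decreases on the positive half-line.

Two further points need an argument. The process comes with a density that is known only through its Fourier transform;
convolution with a small Gaussian shows that it agrees almost everywhere with
the smooth \<open>stable_kernel\<close> (\<open>stable_density_unique\<close>). And \<open>F\<close> is differentiable because the last operator to be applied is an
integral against this smooth kernel, whose derivatives are bounded; the sign of
the derivative is then that of the monotonicity (\<open>mid_cone_derivative_sign\<close>).\<close>

section \<open>Convolution with a unimodal kernel on an interval\<close>

lemma integral_symmetric_interval:
  fixes h :: "real \<Rightarrow> real"
  assumes "0 \<le> a" "continuous_on {-a..a} h"
  shows "integral {-a..a} h = integral {0..a} (\<lambda>y. h y + h (- y))"
proof -
  have int: "h integrable_on {-a..a}"
    using assms(2) by (rule integrable_continuous_real)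
  have c0: "continuous_on {0..a} h" "continuous_on {-a..0} h"
    by (rule continuous_on_subset[OF assms(2)], use assms(1) in auto)+
  have c1: "continuous_on {0..a} (\<lambda>y. h (- y))"
    by (rule continuous_on_compose2[OF c0(2)]) (auto intro!: continuous_intros)
  have "integral {-a..a} h = integral {-a..0} h + integral {0..a} h"
    using assms(1) int by (intro Henstock_Kurzweil_Integration.integral_combine[symmetric]) auto
  also have "integral {-a..0} h = integral {0..a} (\<lambda>y. h (- y))"
    using Henstock_Kurzweil_Integration.integral_reflect_real[of a 0 "\<lambda>y. h (-y)"] by simp
  finally show ?thesis
    using integrable_continuous_real[OF c0(1)] integrable_continuous_real[OF c1]
    by (simp add: Henstock_Kurzweil_Integration.integral_add)
qed

lemma integral_fold_midpoint:
  fixes h :: "real \<Rightarrow> real"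
  assumes "0 \<le> a" "continuous_on {0..a} h"
  shows "integral {0..a} h = integral {0..a/2} (\<lambda>y. h y + h (a - y))"
proof -
  have c0: "continuous_on {0..a/2} h" "continuous_on {a/2..a} h"
    by (rule continuous_on_subset[OF assms(2)], use assms(1) in auto)+
  have c1: "continuous_on {0..a/2} (\<lambda>y. h (a - y))"
    by (rule continuous_on_compose2[OF c0(2)]) (auto intro!: continuous_intros)
  have c2: "continuous_on {-a..-(a/2)} (\<lambda>y. h (- y))"
    by (rule continuous_on_compose2[OF c0(2)]) (auto intro!: continuous_intros)
  have "integral {0..a} h = integral {0..a/2} h + integral {a/2..a} h"
    using assms
    by (intro Henstock_Kurzweil_Integration.integral_combine[symmetric] integrable_continuous_real) auto
  also have "integral {a/2..a} h = integral {-a..-(a/2)} (\<lambda>y. h (- y))"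
    by (rule Henstock_Kurzweil_Integration.integral_reflect_real[symmetric])
  also have "\<dots> = integral {0..a/2} (\<lambda>y. h (a - y))"
    using has_integral_affinity'[OF integrable_integral, of "\<lambda>y. h (- y)" "-a" "-(a/2)" 1 "-a"]
      integrable_continuous_real[OF c2]
    by (simp add: integral_unique)
  finally show ?thesis
    using integrable_continuous_real[OF c0(1)] integrable_continuous_real[OF c1]
    by (simp add: Henstock_Kurzweil_Integration.integral_add)
qed

lemma deriv_even_odd:
  fixes f f' :: "real \<Rightarrow> real"
  assumes "\<And>x. (f has_real_derivative f' x) (at x)" "\<And>x. f (- x) = c * f x"
  shows "f' (- x) = - c * f' x"
proof -
  have "((\<lambda>u. f (- u)) has_real_derivative f' (- x) * (-1)) (at x)"
    by (intro DERIV_chain2[OF assms(1)] derivative_eq_intros) auto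
  then have "((\<lambda>u. c * f u) has_real_derivative f' (- x) * (-1)) (at x)" unfolding assms(2) .
  from DERIV_unique[OF this DERIV_cmult[OF assms(1)]] show ?thesis by simp
qed

lemma convolution_has_derivative:
  fixes k k' f :: "real \<Rightarrow> real"
  assumes dk: "\<And>u. (k has_real_derivative k' u) (at u)" and ck': "continuous_on UNIV k'"
    and cf: "continuous_on {-a..a} f"
  shows "((\<lambda>x. integral {-a..a} (\<lambda>y. k (x - y) * f y)) has_real_derivative
      integral {-a..a} (\<lambda>y. k' (x - y) * f y)) (at x)"
proof -
  have ck: "continuous_on UNIV k"
    using dk DERIV_isCont continuous_at_imp_continuous_on by blast
  have c: "continuous_on (UNIV \<times> cbox (-a) a) (\<lambda>(x, y). k' (x - y) * f y)"
    unfolding split_beta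
    by (intro continuous_intros continuous_on_compose2[OF ck'] continuous_on_compose2[OF cf])
      (auto intro!: continuous_intros)
  have "((\<lambda>x. integral (cbox (-a) a) (\<lambda>y. k (x - y) * f y)) has_real_derivative
      integral (cbox (-a) a) (\<lambda>y. k' (x - y) * f y)) (at x within UNIV)"
  proof (rule leibniz_rule_field_derivative[where U = UNIV])
    show "((\<lambda>x. k (x - t) * f t) has_real_derivative k' (x - t) * f t) (at x within UNIV)" for x t
      by (auto intro!: derivative_eq_intros DERIV_chain2[OF dk])
    show "(\<lambda>y. k (x - y) * f y) integrable_on cbox (- a) a" for x
      unfolding cbox_interval
      by (intro integrable_continuous_real continuous_intros continuous_on_compose2[OF ck] cf)
        (auto intro!: continuous_intros)
  qed (use c in auto)
  then show ?thesis by simp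
qed

text \<open>The derivative falls on \<open>f\<close> and the integral is folded at 0, using that \<open>f'\<close> is odd. The function \<open>k (x - y) - k (x + y)\<close>
that appears is the kernel \<open>k\<close> on the half-line with absorption at 0. The jump of \<open>f\<close>, cut off
outside \<open>[-a, a]\<close>, accounts for the boundary term.\<close>

lemma convolution_by_parts:
  fixes k k' f f' :: "real \<Rightarrow> real"
  assumes df: "\<And>y. (f has_real_derivative f' y) (at y)" and cf': "continuous_on UNIV f'"
    and even_f: "\<And>y. f (- y) = f y" and a: "0 \<le> a"
    and dk: "\<And>u. (k has_real_derivative k' u) (at u)" and ck': "continuous_on UNIV k'"
  shows "integral {-a..a} (\<lambda>y. k' (x - y) * f y) =
    integral {0..a} (\<lambda>y. (k (x - y) - k (x + y)) * f' y) - (k (x - a) - k (x + a)) * f a"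
proof -
  have cf: "continuous_on S f" for S
    using df DERIV_isCont continuous_at_imp_continuous_on by blast
  have ck: "continuous_on S k" for S
    using dk DERIV_isCont continuous_at_imp_continuous_on by blast
  have odd: "f' (- y) = - f' y" for y
    using deriv_even_odd[of f f' 1] df even_f by simp
  note c = continuous_intros continuous_on_compose2[OF ck] continuous_on_compose2[OF ck']
    continuous_on_compose2[OF cf'] continuous_on_compose2[OF cf]
  have i1: "(\<lambda>y. k' (x - y) * f y) integrable_on {-a..a}"
    and i2: "(\<lambda>y. k (x - y) * f' y) integrable_on {-a..a}"
    by (intro integrable_continuous_real c, auto)+
  have "((\<lambda>y. k (x - y) * f' y - k' (x - y) * f y) has_integral
      k (x - a) * f a - k (x - (-a)) * f (-a)) {-a..a}"
    by (rule fundamental_theorem_of_calculus)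
      (use a in \<open>auto intro!: derivative_eq_intros DERIV_chain2[OF dk] DERIV_subset[OF df]
         simp: has_real_derivative_iff_has_vector_derivative[symmetric] DERIV_subset[OF df]\<close>)
  then have "integral {-a..a} (\<lambda>y. k (x - y) * f' y - k' (x - y) * f y) =
      (k (x - a) - k (x + a)) * f a"
    by (simp add: integral_unique even_f algebra_simps)
  moreover have "integral {-a..a} (\<lambda>y. k (x - y) * f' y) =
      integral {0..a} (\<lambda>y. (k (x - y) - k (x + y)) * f' y)"
    using a by (subst integral_symmetric_interval) (auto intro!: c simp: odd algebra_simps)
  ultimately show ?thesis
    using i1 i2 by (simp add: Henstock_Kurzweil_Integration.integral_diff)
qed

text \<open>The last condition compares the slopes at two points that are mirror images in \<open>a/2\<close>; it is what makes the
concavity on \<open>[0, a/2]\<close> stable under smoothing. Everything is expressed by derivatives on the nonnegative half-line,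
evenness taking care of the other half. Smoothness is required on the whole line, which spares one-sided
derivatives at the end points.\<close>

definition axis_profile :: "real \<Rightarrow> (real \<Rightarrow> real) \<Rightarrow> bool" where
  "axis_profile a f \<longleftrightarrow>
     (\<exists>f' f''. (\<forall>x. (f has_real_derivative f' x) (at x)) \<and>
        (\<forall>x. (f' has_real_derivative f'' x) (at x)) \<and> continuous_on UNIV f'' \<and>
        (\<forall>x. f (- x) = f x) \<and>
        (\<forall>x\<in>{0..a}. 0 \<le> f x \<and> f' x \<le> 0) \<and>
        (\<forall>x\<in>{0..a/2}. f'' x \<le> 0 \<and> f' (a - x) \<le> f' x))"

lemma axis_profile_const_1: "axis_profile a (\<lambda>_. 1)"
  unfolding axis_profile_def by (rule exI[of _ "\<lambda>_. 0"], rule exI[of _ "\<lambda>_. 0"]) auto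

locale unimodal_kernel =
  fixes p p' p'' :: "real \<Rightarrow> real"
  assumes deriv: "\<And>u. (p has_real_derivative p' u) (at u)"
    and deriv2: "\<And>u. (p' has_real_derivative p'' u) (at u)"
    and cont2: "continuous_on UNIV p''"
    and even: "\<And>u. p (- u) = p u"
    and nonneg: "\<And>u. 0 \<le> p u"
    and decreasing: "\<And>u. 0 \<le> u \<Longrightarrow> p' u \<le> 0"
begin

lemma cont: "continuous_on S p"
  using deriv DERIV_isCont continuous_at_imp_continuous_on by blast

lemma cont1: "continuous_on S p'"
  using deriv2 DERIV_isCont continuous_at_imp_continuous_on by blast

lemma antimono_abs:
  assumes "\<bar>u\<bar> \<le> \<bar>v\<bar>"
  shows "p v \<le> p u"
proof -
  have "p \<bar>v\<bar> \<le> p \<bar>u\<bar>"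
    by (rule DERIV_nonpos_imp_nonincreasing[OF assms])
      (meson abs_ge_zero order_trans deriv decreasing)
  moreover have "p \<bar>w\<bar> = p w" for w by (cases "w \<ge> 0") (auto simp: even)
  ultimately show ?thesis by simp
qed

lemma deriv_odd: "p' (- u) = - p' u"
  using deriv_even_odd[of p p' 1] deriv even by simp

lemma deriv_nonneg: "u \<le> 0 \<Longrightarrow> 0 \<le> p' u"
  using decreasing[of "-u"] deriv_odd[of u] by auto

text \<open>For \<open>0 \<le> x, y\<close> the kernel \<open>q x y = p (x - y) - p (x + y)\<close> is nonnegative, and it increases in \<open>x\<close> as
long as \<open>x \<le> y\<close>. The slope of \<open>f\<close> beyond \<open>a/2\<close> contributes with the right sign to all three inequalities, and
the reflection condition on \<open>f'\<close> says that this contribution is at least the mirror image of the one from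
below \<open>a/2\<close>. After folding at \<open>a/2\<close> it remains to compare distances: for \<open>x, y\<close> in \<open>[0, a/2]\<close> the point \<open>x\<close> is closer to \<open>y\<close> than to \<open>a - y\<close>.\<close>

proposition axis_profile_convolution:
  assumes a: "0 < a" and f: "axis_profile a f"
  shows "axis_profile a (\<lambda>x. integral {-a..a} (\<lambda>y. p (x - y) * f y))"
proof -
  obtain f' f'' where df: "\<And>x. (f has_real_derivative f' x) (at x)"
    and df': "\<And>x. (f' has_real_derivative f'' x) (at x)" and cf'': "continuous_on UNIV f''"
    and even_f: "\<And>x. f (- x) = f x"
    and f_nonneg: "\<And>x. x \<in> {0..a} \<Longrightarrow> 0 \<le> f x" and f'_nonpos: "\<And>x. x \<in> {0..a} \<Longrightarrow> f' x \<le> 0"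
    and f''_nonpos: "\<And>x. x \<in> {0..a/2} \<Longrightarrow> f'' x \<le> 0"
    and f'_reflect: "\<And>x. x \<in> {0..a/2} \<Longrightarrow> f' (a - x) \<le> f' x"
    using f unfolding axis_profile_def by blast
  have cf: "continuous_on S f" for S
    using df DERIV_isCont continuous_at_imp_continuous_on by blast
  have cf': "continuous_on S f'" for S
    using df' DERIV_isCont continuous_at_imp_continuous_on by blast
  have cf''_S: "continuous_on S f''" for S
    using cf'' by (rule continuous_on_subset) auto
  note c = continuous_intros continuous_on_compose2[OF cont] continuous_on_compose2[OF cont1]
    continuous_on_compose2[OF cont2] continuous_on_compose2[OF cf'] continuous_on_compose2[OF cf]
    continuous_on_compose2[OF cf'']
  have f'0: "f' 0 = 0"
    using deriv_even_odd[of f f' 1 0] df even_f by simp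
  define G where "G x = integral {-a..a} (\<lambda>y. p (x - y) * f y)" for x
  define G' where "G' x = integral {-a..a} (\<lambda>y. p' (x - y) * f y)" for x
  define G'' where "G'' x = integral {-a..a} (\<lambda>y. p'' (x - y) * f y)" for x
  define q where "q x y = p (x - y) - p (x + y)" for x y
  define q' where "q' x y = p' (x - y) - p' (x + y)" for x y
  define r where "r x y = p (x - y) + p (x + y)" for x y
  have dG: "(G has_real_derivative G' x) (at x)" for x
    unfolding G_def G'_def by (rule convolution_has_derivative[OF deriv cont1 cf])
  have dG': "(G' has_real_derivative G'' x) (at x)" for x
    unfolding G''_def G'_def by (rule convolution_has_derivative[OF deriv2 cont2 cf])
  have cG'': "continuous_on UNIV G''"
  proof -
    have c2: "continuous_on (UNIV \<times> cbox (-a) a) (\<lambda>(x, y). p'' (x - y) * f y)"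
      unfolding split_beta by (intro c) auto
    have "continuous_on UNIV (\<lambda>x. integral (cbox (-a) a) (\<lambda>y. p'' (x - y) * f y))"
      by (rule integral_continuous_on_param[OF c2])
    then show ?thesis unfolding G''_def by simp
  qed
  have evenG: "G (- x) = G x" for x
  proof -
    have "G x = integral {-a..a} (\<lambda>y. p (x + y) * f y)"
      unfolding G_def using Henstock_Kurzweil_Integration.integral_reflect_real[of a "-a" "\<lambda>y. p (x + y) * f y"]
      by (simp add: even_f)
    also have "\<dots> = G (- x)"
      unfolding G_def
      by (intro integral_cong) (use even in \<open>metis add.commute minus_diff_eq diff_minus_eq_add minus_minus\<close>)
    finally show ?thesis ..
  qed
  have G'_eq: "G' x = integral {0..a} (\<lambda>y. q x y * f' y) - q x a * f a" for x
    unfolding G'_def q_def using a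
    by (intro convolution_by_parts df cf' even_f deriv cont1) auto
  \<comment> \<open>The same formula one derivative higher; \<open>q'\<close> is the partial derivative of \<open>q\<close> in \<open>x\<close>.\<close>
  have G''_eq: "G'' x = integral {0..a} (\<lambda>y. q' x y * f' y) - q' x a * f a" for x
    unfolding G''_def q'_def using a
    by (intro convolution_by_parts df cf' even_f deriv2 cont2) auto
  have q_nonneg: "0 \<le> q x y" if "0 \<le> x" "0 \<le> y" for x y
    unfolding q_def using antimono_abs[of "x - y" "x + y"] that by auto
  have fa: "0 \<le> f a" using f_nonneg[of a] a by auto
  have cq: "continuous_on S (\<lambda>y. q x (g y))" and cq': "continuous_on S (\<lambda>y. q' x (g y))"
    and cr: "continuous_on S (\<lambda>y. r x (g y))"
    if "continuous_on S g" for x S g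
    unfolding q_def q'_def r_def by (intro c that; auto)+
  have G_nonneg: "0 \<le> G x" for x
    unfolding G_def
  proof (intro integral_nonneg integrable_continuous_real c)
    fix y assume "y \<in> {-a..a}"
    then have "0 \<le> f y" using f_nonneg[of y] f_nonneg[of "-y"] even_f[of y] by (cases "0 \<le> y") auto
    then show "0 \<le> p (x - y) * f y" using nonneg by simp
  qed auto
  have G'_nonpos: "G' x \<le> 0" if "x \<in> {0..a}" for x
  proof -
    have "integral {0..a} (\<lambda>y. q x y * f' y) \<le> integral {0..a} (\<lambda>y. 0)"
      using that q_nonneg f'_nonpos
      by (intro integral_le integrable_continuous_real c cq) (auto intro: mult_nonneg_nonpos)
    moreover have "0 \<le> q x a * f a" using that fa q_nonneg a by auto
    ultimately show ?thesis unfolding G'_eq by simp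
  qed
  have q'_nonneg: "0 \<le> q' x y" if "0 \<le> x" "x \<le> y" for x y
    unfolding q'_def using deriv_nonneg[of "x - y"] decreasing[of "x + y"] that by auto
  have G''_nonpos: "G'' x \<le> 0" if x: "x \<in> {0..a/2}" for x
  proof -
    \<comment> \<open>The derivative of \<open>r x\<close> is \<open>- q' x\<close>, so \<open>W\<close> is an antiderivative of the folded kernel. Both boundary terms vanish in the
integration by parts: \<open>W\<close> is zero at \<open>a/2\<close> and \<open>f'\<close> is zero at 0.\<close>
    define W where "W y = r x (a - y) - r x y" for y
    have dW: "(W has_real_derivative q' x y + q' x (a - y)) (at y)" for y
      unfolding W_def r_def q'_def
      by (auto intro!: derivative_eq_intros DERIV_chain2[OF deriv])
    have cW: "continuous_on S W" for S
      using dW DERIV_isCont continuous_at_imp_continuous_on by blast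
    have W_nonpos: "W y \<le> 0" if "y \<in> {0..a/2}" for y
    proof -
      have "\<bar>x - y\<bar> \<le> \<bar>x - (a - y)\<bar>" "\<bar>x + y\<bar> \<le> \<bar>x + (a - y)\<bar>"
        using x that by (auto simp: abs_if)
      from this[THEN antimono_abs] show ?thesis unfolding W_def r_def by simp
    qed
    have "((\<lambda>y. (q' x y + q' x (a - y)) * f' y + W y * f'' y) has_integral
        W (a/2) * f' (a/2) - W 0 * f' 0) {0..a/2}"
      by (rule fundamental_theorem_of_calculus)
        (use a in \<open>auto intro!: derivative_eq_intros DERIV_subset[OF dW] DERIV_subset[OF df']
           simp: has_real_derivative_iff_has_vector_derivative[symmetric] algebra_simps\<close>)
    moreover have "W (a/2) = 0" unfolding W_def by simp
    ultimately have z: "integral {0..a/2} (\<lambda>y. (q' x y + q' x (a - y)) * f' y + W y * f'' y) = 0"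
      by (simp add: integral_unique f'0)
    have i1: "(\<lambda>y. (q' x y + q' x (a - y)) * f' y) integrable_on {0..a/2}"
      and i2: "(\<lambda>y. W y * f'' y) integrable_on {0..a/2}"
      by (intro integrable_continuous_real c cq' cW cf' cf''_S; auto)+
    have "integral {0..a} (\<lambda>y. q' x y * f' y) =
        integral {0..a/2} (\<lambda>y. q' x y * f' y + q' x (a - y) * f' (a - y))"
      using a by (intro integral_fold_midpoint c cq') auto
    also have "\<dots> \<le> integral {0..a/2} (\<lambda>y. (q' x y + q' x (a - y)) * f' y)"
    proof (intro integral_le i1)
      show "(\<lambda>y. q' x y * f' y + q' x (a - y) * f' (a - y)) integrable_on {0..a/2}"
        by (intro integrable_continuous_real c cq') auto
      fix y assume y: "y \<in> {0..a/2}"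
      have "q' x (a - y) * f' (a - y) \<le> q' x (a - y) * f' y"
        using x y f'_reflect[OF y] by (intro mult_left_mono q'_nonneg) auto
      then show "q' x y * f' y + q' x (a - y) * f' (a - y) \<le> (q' x y + q' x (a - y)) * f' y"
        by (simp add: algebra_simps)
    qed
    also have "\<dots> = - integral {0..a/2} (\<lambda>y. W y * f'' y)"
      using z i1 i2 by (simp add: Henstock_Kurzweil_Integration.integral_add)
    also have "\<dots> \<le> 0"
      using integral_nonneg[OF i2] W_nonpos f''_nonpos by (auto intro: mult_nonpos_nonpos)
    finally have "integral {0..a} (\<lambda>y. q' x y * f' y) \<le> 0" .
    moreover have "0 \<le> q' x a * f a" using x fa q'_nonneg[of x a] a by auto
    ultimately show ?thesis unfolding G''_eq by simp
  qed
  have G'_reflect: "G' (a - x) \<le> G' x" if x: "x \<in> {0..a/2}" for x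
  proof -
    define D where "D y = q x y - q (a - x) y" for y
    have cD: "continuous_on S (\<lambda>y. D (g y))" if "continuous_on S g" for S g
      unfolding D_def by (intro c cq that)
    have D_nonpos: "D y \<le> 0" if "y \<in> {a/2..a}" for y
    proof -
      have "\<bar>x + y\<bar> \<le> \<bar>a - x + y\<bar>" "\<bar>a - x - y\<bar> \<le> \<bar>x - y\<bar>"
        using x that by (auto simp: abs_if)
      from this[THEN antimono_abs] show ?thesis unfolding D_def q_def by simp
    qed
    \<comment> \<open>The terms in \<open>x - y\<close> cancel when \<open>y\<close> is paired with \<open>a - y\<close>; only the subtracted reflected terms are left.\<close>
    have D_fold: "D y + D (a - y) \<le> 0" if "y \<in> {0..a/2}" for y
    proof -
      have "p (x - (a - y)) = p (a - x - y)" "p (x - y) = p (a - x - (a - y))"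
        using even[of "x - (a - y)"] even[of "x - y"] by (simp_all add: algebra_simps)
      moreover have "p (a - x + y) \<le> p (x + y)" "p (a - x + (a - y)) \<le> p (x + (a - y))"
        by (rule antimono_abs; use x that in auto)+
      ultimately show ?thesis unfolding D_def q_def by simp
    qed
    have "0 \<le> integral {0..a/2} (\<lambda>y. D y * f' y + D (a - y) * f' (a - y))"
    proof (intro integral_nonneg integrable_continuous_real c cD)
      fix y assume y: "y \<in> {0..a/2}"
      have "D (a - y) * f' y \<le> D (a - y) * f' (a - y)"
        using y f'_reflect[OF y] by (intro mult_left_mono_neg D_nonpos) auto
      moreover have "0 \<le> (D y + D (a - y)) * f' y"
        using D_fold[OF y] f'_nonpos[of y] y by (intro mult_nonpos_nonpos) auto
      ultimately show "0 \<le> D y * f' y + D (a - y) * f' (a - y)" by (simp add: algebra_simps)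
    qed auto
    also have "\<dots> = integral {0..a} (\<lambda>y. D y * f' y)"
      using a by (intro integral_fold_midpoint[symmetric] c cD) auto
    also have "\<dots> = integral {0..a} (\<lambda>y. q x y * f' y) - integral {0..a} (\<lambda>y. q (a - x) y * f' y)"
      unfolding D_def left_diff_distrib
      by (intro Henstock_Kurzweil_Integration.integral_diff integrable_continuous_real c cq) auto
    finally have "0 \<le> \<dots>" .
    moreover have "0 \<le> - D a * f a" using D_nonpos[of a] fa a by (intro mult_nonneg_nonneg) auto
    ultimately show ?thesis unfolding G'_eq by (simp add: D_def algebra_simps)
  qed
  show ?thesis
    unfolding axis_profile_def G_def[symmetric]
    using dG dG' cG'' evenG G_nonneg G'_nonpos G''_nonpos G'_reflect by blast
qed

end

lemma axis_profile_continuous: "axis_profile a f \<Longrightarrow> continuous_on S f"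
  unfolding axis_profile_def by (metis DERIV_isCont continuous_at_imp_continuous_on)

lemma axis_profile_abs: "axis_profile a f \<Longrightarrow> f \<bar>x\<bar> = f x"
  unfolding axis_profile_def by (metis abs_if)

lemma axis_profile_nonneg: "axis_profile a f \<Longrightarrow> \<bar>x\<bar> \<le> a \<Longrightarrow> 0 \<le> f x"
  using axis_profile_abs[of a f x] unfolding axis_profile_def
  by (metis abs_ge_zero atLeastAtMost_iff)

lemma axis_profile_antimono:
  assumes f: "axis_profile a f" and "\<bar>u\<bar> \<le> \<bar>v\<bar>" "\<bar>v\<bar> \<le> a"
  shows "f v \<le> f u"
proof -
  obtain f' where d: "\<And>x. (f has_real_derivative f' x) (at x)" "\<And>x. x \<in> {0..a} \<Longrightarrow> f' x \<le> 0"
    using f unfolding axis_profile_def by blast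
  have "f \<bar>v\<bar> \<le> f \<bar>u\<bar>"
  proof (rule DERIV_nonpos_imp_nonincreasing[OF assms(2)])
    fix x assume "\<bar>u\<bar> \<le> x" "x \<le> \<bar>v\<bar>"
    then show "\<exists>y. (f has_real_derivative y) (at x) \<and> y \<le> 0"
      using d(1)[of x] d(2)[of x] assms(3) by auto
  qed
  then show ?thesis by (simp add: axis_profile_abs[OF f])
qed

lemma axis_profile_concave:
  assumes f: "axis_profile a f"
  shows "concave_on {-(a/2)..a/2} f"
proof -
  obtain f' f'' where d: "\<And>x. (f has_real_derivative f' x) (at x)"
    "\<And>x. (f' has_real_derivative f'' x) (at x)" "\<And>x. f (- x) = f x"
    "\<And>x. x \<in> {0..a/2} \<Longrightarrow> f'' x \<le> 0"
    using f unfolding axis_profile_def by blast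
  have "f' (- x) = -1 * f' x" for x using deriv_even_odd[of f f' 1 x] d by simp
  then have "f'' (- x) = f'' x" for x using deriv_even_odd[of f' f'' "-1" x] d by simp
  then have "f'' x \<le> 0" if "x \<in> {-(a/2)..a/2}" for x
    using d(4)[of x] d(4)[of "-x"] that by (cases "0 \<le> x") auto
  then show ?thesis
    by (intro f''_le0_imp_concave[where f' = f' and f'' = f''] d(1,2)) auto
qed

section \<open>The cone generated by products of profiles\<close>

text \<open>Closure under limits replaces integration against mixing measures. The
bound is required on the box only, because profiles may be unbounded outside, and the values
there do not enter the operators below; convergence is required everywhere so that the limit is measurable.\<close>

inductive mid_cone :: "real^'n::finite \<Rightarrow> (real^'n \<Rightarrow> real) \<Rightarrow> bool" for a where
  product: "(\<And>i. axis_profile (a $ i) (f i)) \<Longrightarrow> mid_cone a (\<lambda>x. \<Prod>i\<in>UNIV. f i (x $ i))"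
| add: "mid_cone a F \<Longrightarrow> mid_cone a G \<Longrightarrow> mid_cone a (\<lambda>x. F x + G x)"
| scale: "mid_cone a F \<Longrightarrow> 0 \<le> c \<Longrightarrow> mid_cone a (\<lambda>x. c * F x)"
| limit: "(\<And>k. mid_cone a (F k)) \<Longrightarrow> (\<And>k x. x \<in> box (- a) a \<Longrightarrow> \<bar>F k x\<bar> \<le> B) \<Longrightarrow>
    (\<And>x. (\<lambda>k. F k x) \<longlonglongrightarrow> G x) \<Longrightarrow> mid_cone a G"

lemma mid_cone_const_1: "mid_cone a (\<lambda>_. 1)"
  using mid_cone.product[of a "\<lambda>_ _. 1"] axis_profile_const_1 by simp

lemma mid_cone_measurable [measurable_dest]: "mid_cone a F \<Longrightarrow> F \<in> borel_measurable borel"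
proof (induction rule: mid_cone.induct)
  case (product f)
  have "continuous_on UNIV (f i)" for i
    using product axis_profile_continuous by blast
  then have [measurable]: "f i \<in> borel_measurable borel" for i
    by (rule borel_measurable_continuous_onI)
  show ?case by measurable
next
  case (limit F B G)
  then show ?case by (intro borel_measurable_LIMSEQ_real[where u = F and u' = G])
qed auto

lemma mid_cone_bounded:
  assumes "mid_cone a F"
  obtains B where "\<And>x. x \<in> box (- a) a \<Longrightarrow> \<bar>F x\<bar> \<le> B"
proof -
  have "\<exists>B. \<forall>x\<in>box (- a) a. \<bar>F x\<bar> \<le> B"
    using assms
  proof (induction rule: mid_cone.induct)
    case (product f)
    have "compact ((\<lambda>x. \<Prod>i\<in>UNIV. f i (x $ i)) ` cbox (- a) a)"
      by (intro compact_continuous_image continuous_intros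
          continuous_on_compose2[OF axis_profile_continuous[OF product]]) auto
    then obtain B where "\<forall>y\<in>(\<lambda>x. \<Prod>i\<in>UNIV. f i (x $ i)) ` cbox (- a) a. norm y \<le> B"
      using compact_imp_bounded bounded_iff by blast
    then show ?case using box_subset_cbox[of "-a" a] by (intro exI[of _ B]) auto
  next
    case (add F G)
    then obtain B C where "\<forall>x\<in>box (- a) a. \<bar>F x\<bar> \<le> B" "\<forall>x\<in>box (- a) a. \<bar>G x\<bar> \<le> C" by blast
    then have "\<forall>x\<in>box (- a) a. \<bar>F x + G x\<bar> \<le> B + C"
      using abs_triangle_ineq add_mono order_trans by meson
    then show ?case by blast
  next
    case (scale F c)
    then obtain B where "\<forall>x\<in>box (- a) a. \<bar>F x\<bar> \<le> B" by blast
    then have "\<forall>x\<in>box (- a) a. \<bar>c * F x\<bar> \<le> c * B"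
      using scale.hyps by (auto simp: abs_mult intro: mult_left_mono)
    then show ?case by blast
  next
    case (limit F B G)
    have "\<bar>G x\<bar> \<le> B" if "x \<in> box (- a) a" for x
      by (rule LIMSEQ_le_const2[OF tendsto_rabs[OF limit.hyps(3)[of x]]]) (use limit.hyps(2)[OF that] in auto)
    then show ?case by blast
  qed
  then show ?thesis using that by blast
qed

lemma set_coord_nth: "set_coord x i c $ j = (if j = i then c else x $ j)"
  unfolding set_coord_def by simp

lemma prod_set_coord:
  "(\<Prod>j\<in>UNIV. f j (set_coord x i c $ j)) = f i c * (\<Prod>j\<in>UNIV - {i}. f j (x $ j))"
  for f :: "'n::finite \<Rightarrow> real \<Rightarrow> real"
  by (subst prod.remove[of _ i]) (auto simp: set_coord_nth intro!: arg_cong2[of _ _ _ _ "(*)"] prod.cong)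

text \<open>Both this property and the next are families of linear inequalities between values of the function, so they pass to sums, multiples
and limits. For a product, the factors that belong to the other coordinates are nonnegative constants.\<close>

lemma mid_cone_antimono:
  assumes "mid_cone a F" "x \<in> box (- a) a" "\<bar>u\<bar> \<le> \<bar>v\<bar>" "\<bar>v\<bar> \<le> a $ i"
  shows "F (set_coord x i v) \<le> F (set_coord x i u)"
  using assms(1)
proof (induction rule: mid_cone.induct)
  case (product f)
  have "0 \<le> f j (x $ j)" for j
    using assms(2) by (intro axis_profile_nonneg[OF product]) (auto simp: mem_box_cart abs_le_iff dest: spec[of _ j])
  then show ?case
    unfolding prod_set_coord using axis_profile_antimono[OF product assms(3,4)]
    by (intro mult_right_mono prod_nonneg) auto
next
  case (limit F B G)
  show ?case by (rule LIMSEQ_le[OF limit.hyps(3) limit.hyps(3)]) (use limit.IH in auto)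
qed (auto intro: add_mono mult_left_mono)

lemma mid_cone_concave:
  assumes "mid_cone a F" "x \<in> box (- a) a"
  shows "concave_on {-(a $ i / 2)..a $ i / 2} (\<lambda>u. F (set_coord x i u))"
  using assms(1)
proof (induction rule: mid_cone.induct)
  case (product f)
  have "0 \<le> f j (x $ j)" for j
    using assms(2) by (intro axis_profile_nonneg[OF product]) (auto simp: mem_box_cart abs_le_iff dest: spec[of _ j])
  then show ?case
    unfolding prod_set_coord mult.commute[of "f i _" for i] using axis_profile_concave[OF product]
    by (intro concave_on_cmul prod_nonneg) auto
next
  case (limit F B G)
  show ?case
    unfolding concave_on_iff
  proof (intro conjI ballI allI impI)
    fix y z u v :: real
    assume *: "y \<in> {-(a $ i / 2)..a $ i / 2}" "z \<in> {-(a $ i / 2)..a $ i / 2}" "0 \<le> u" "0 \<le> v" "u + v = 1"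
    show "u * G (set_coord x i y) + v * G (set_coord x i z) \<le> G (set_coord x i (u *\<^sub>R y + v *\<^sub>R z))"
    proof (rule LIMSEQ_le[OF tendsto_add[OF tendsto_mult_left[OF limit.hyps(3)] tendsto_mult_left[OF limit.hyps(3)]] limit.hyps(3)],
        intro exI[of _ 0] allI impI)
      fix k
      show "u * F k (set_coord x i y) + v * F k (set_coord x i z) \<le> F k (set_coord x i (u *\<^sub>R y + v *\<^sub>R z))"
        using limit.IH[of k] * unfolding concave_on_iff by blast
    qed
  qed auto
qed (auto intro: concave_on_add concave_on_cmul)

section \<open>Gaussian steps preserve the cone\<close>

lemma measurable_vec_lambda [measurable]:
  "(\<lambda>z. \<chi> i. z i) \<in> measurable (\<Pi>\<^sub>M i\<in>(UNIV::'n::finite set). (lborel :: real measure)) (borel :: (real^'n) measure)"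
proof -
  have "(\<chi> i. z i) = (\<Sum>i\<in>UNIV. z i *\<^sub>R axis i 1)" for z :: "'n \<Rightarrow> real"
    by (simp add: vec_eq_iff axis_def if_distrib[of "\<lambda>x. _ * x"] cong: if_cong)
  then show ?thesis by simp
qed

lemma lborel_cart: "(lborel :: (real^'n::finite) measure) =
    distr (\<Pi>\<^sub>M i\<in>UNIV. lborel) borel (\<lambda>z. \<chi> i. z i)"
proof (rule lborel_eqI)
  fix l u :: "real^'n" assume lu: "\<And>b. b \<in> Basis \<Longrightarrow> l \<bullet> b \<le> u \<bullet> b"
  have le: "l $ i \<le> u $ i" for i using lu[of "axis i 1"] by (simp add: inner_axis)
  interpret product_sigma_finite "\<lambda>_::'n. lborel :: real measure" ..
  have "emeasure (distr (\<Pi>\<^sub>M i\<in>(UNIV::'n set). lborel) borel (\<lambda>z. \<chi> i. z i)) (box l u) =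
      emeasure (\<Pi>\<^sub>M i\<in>(UNIV::'n set). lborel) (\<Pi>\<^sub>E i\<in>UNIV. {l $ i<..<u $ i})"
    by (subst emeasure_distr) (auto intro!: arg_cong2[of _ _ _ _ emeasure] simp: mem_box_cart space_PiM PiE_iff)
  also have "\<dots> = (\<Prod>i\<in>UNIV. ennreal (u $ i - l $ i))"
    by (subst emeasure_PiM) (auto simp: le)
  also have "\<dots> = ennreal (\<Prod>i\<in>UNIV. u $ i - l $ i)" by (rule prod_ennreal) (simp add: le)
  also have "(\<Prod>i\<in>UNIV. u $ i - l $ i) = (\<Prod>b\<in>Basis. (u - l) \<bullet> b)"
    by (simp add: Basis_vec_def UNION_singleton_eq_range prod.reindex axis_eq_axis inj_on_def inner_axis)
  finally show "emeasure (distr (\<Pi>\<^sub>M i\<in>UNIV. lborel) borel (\<lambda>z. \<chi> i. z i)) (box l u) =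
      ennreal (\<Prod>b\<in>Basis. (u - l) \<bullet> b)" .
qed simp

lemma integral_prod_cart:
  fixes f :: "'n::finite \<Rightarrow> real \<Rightarrow> 'a::{real_normed_field,banach,second_countable_topology}"
  assumes "\<And>i. integrable lborel (f i)"
  shows "integrable lborel (\<lambda>x::real^'n. \<Prod>i\<in>UNIV. f i (x $ i))" (is ?int)
    and "(\<integral>x. (\<Prod>i\<in>UNIV. f i (x $ i)) \<partial>(lborel :: (real^'n) measure)) = (\<Prod>i\<in>UNIV. integral\<^sup>L lborel (f i))"
      (is ?eq)
proof -
  interpret product_sigma_finite "\<lambda>_::'n. lborel :: real measure" ..
  have [measurable]: "f i \<in> borel_measurable borel" for i
    using borel_measurable_integrable[OF assms[of i]] by simp
  show ?int
    by (subst lborel_cart, subst integrable_distr_eq)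
      (simp_all add: product_integrable_prod assms)
  show ?eq
    by (subst lborel_cart, subst integral_distr)
      (simp_all add: product_integral_prod assms)
qed

text \<open>One step of a random walk with transition density \<open>K (x - y)\<close>, killed on leaving \<open>Q\<close>: the convolution of \<open>K\<close> with \<open>1\<^sub>Q F\<close>.\<close>

definition killed_step :: "'a::euclidean_space set \<Rightarrow> ('a \<Rightarrow> real) \<Rightarrow> ('a \<Rightarrow> real) \<Rightarrow> 'a \<Rightarrow> real" where
  "killed_step Q K F x = (\<integral>y. indicator Q y * (K (x - y) * F y) \<partial>lborel)"

lemma integrable_killed_step:
  fixes K F :: "'a::euclidean_space \<Rightarrow> real"
  assumes [measurable]: "K \<in> borel_measurable borel" "F \<in> borel_measurable borel" "Q \<in> sets borel"
    and "bounded Q" and K: "\<And>z. \<bar>K z\<bar> \<le> C" and F: "\<And>y. y \<in> Q \<Longrightarrow> \<bar>F y\<bar> \<le> B"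
  shows "integrable lborel (\<lambda>y. indicator Q y * (K (x - y) * F y))"
proof (rule Bochner_Integration.integrable_bound)
  show "integrable lborel (\<lambda>y. indicator Q y * (C * B))"
    using emeasure_bounded_finite[OF \<open>bounded Q\<close>]
    by (intro integrable_mult_left integrable_real_indicator) auto
  have "\<bar>K (x - y) * F y\<bar> \<le> \<bar>C * B\<bar>" if "y \<in> Q" for y
  proof -
    have "\<bar>K (x - y)\<bar> * \<bar>F y\<bar> \<le> C * B" using K F[OF that]
      by (intro mult_mono) (auto intro: order_trans[OF abs_ge_zero])
    then show ?thesis using abs_ge_self[of "C * B"] by (simp add: abs_mult)
  qed
  then show "AE y in lborel. norm (indicator Q y * (K (x - y) * F y)) \<le> norm (indicator Q y * (C * B))"
    by (auto simp: indicator_def)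
qed simp

lemma killed_step_bounded:
  fixes K F :: "'a::euclidean_space \<Rightarrow> real"
  assumes "K \<in> borel_measurable borel" "F \<in> borel_measurable borel" "Q \<in> sets borel"
    and "bounded Q" and K: "\<And>z. \<bar>K z\<bar> \<le> C" and F: "\<And>y. y \<in> Q \<Longrightarrow> \<bar>F y\<bar> \<le> B"
  shows "\<bar>killed_step Q K F x\<bar> \<le> C * B * measure lborel Q"
proof -
  have fin: "emeasure lborel Q < \<infinity>" using emeasure_bounded_finite[OF \<open>bounded Q\<close>] .
  have "\<bar>killed_step Q K F x\<bar> \<le> (\<integral>y. \<bar>indicator Q y * (K (x - y) * F y)\<bar> \<partial>lborel)"
    unfolding killed_step_def by (rule integral_abs_bound)
  also have "\<dots> \<le> (\<integral>y. indicator Q y * (C * B) \<partial>lborel)"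
  proof (rule integral_mono)
    show "integrable lborel (\<lambda>y. \<bar>indicator Q y * (K (x - y) * F y)\<bar>)"
      using integrable_killed_step[OF assms] by (rule integrable_abs)
    show "integrable lborel (\<lambda>y. indicator Q y * (C * B))"
      using fin assms(3) by (intro integrable_mult_left integrable_real_indicator) auto
    fix y
    have "\<bar>K (x - y)\<bar> * \<bar>F y\<bar> \<le> C * B" if "y \<in> Q"
      using K F[OF that] by (intro mult_mono) (auto intro: order_trans[OF abs_ge_zero])
    then show "\<bar>indicator Q y * (K (x - y) * F y)\<bar> \<le> indicator Q y * (C * B)"
      by (auto simp: indicator_def abs_mult)
  qed
  also have "\<dots> = C * B * measure lborel Q" using assms(3) fin by simp
  finally show ?thesis .
qed

text \<open>Both the kernel and the function may vary; boundedness of \<open>Q\<close> makes a constant on \<open>Q\<close> a dominating function.\<close>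

lemma killed_step_tendsto:
  fixes K F :: "nat \<Rightarrow> 'a::euclidean_space \<Rightarrow> real"
  assumes [measurable]: "\<And>k. K k \<in> borel_measurable borel" "\<And>k. F k \<in> borel_measurable borel" "Q \<in> sets borel"
    and Q: "bounded Q" and K: "\<And>k z. \<bar>K k z\<bar> \<le> C" and F: "\<And>k y. y \<in> Q \<Longrightarrow> \<bar>F k y\<bar> \<le> B"
    and K_lim: "\<And>z. (\<lambda>k. K k z) \<longlonglongrightarrow> K' z" and F_lim: "\<And>z. (\<lambda>k. F k z) \<longlonglongrightarrow> F' z"
  shows "(\<lambda>k. killed_step Q (K k) (F k) x) \<longlonglongrightarrow> killed_step Q K' F' x"
  unfolding killed_step_def
proof (rule integral_dominated_convergence[where w = "\<lambda>y. indicator Q y * (C * B)"])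
  have [measurable]: "K' \<in> borel_measurable borel" "F' \<in> borel_measurable borel"
    by (rule borel_measurable_LIMSEQ_real[OF K_lim], simp)
      (rule borel_measurable_LIMSEQ_real[OF F_lim], simp)
  show "(\<lambda>y. indicator Q y * (K' (x - y) * F' y)) \<in> borel_measurable lborel" by simp
  show "integrable lborel (\<lambda>y. indicator Q y * (C * B))"
    using emeasure_bounded_finite[OF Q]
    by (intro integrable_mult_left integrable_real_indicator) auto
  show "AE y in lborel. (\<lambda>k. indicator Q y * (K k (x - y) * F k y)) \<longlonglongrightarrow> indicator Q y * (K' (x - y) * F' y)"
    by (intro AE_I2 tendsto_intros K_lim F_lim)
  fix k
  have "\<bar>K k (x - y)\<bar> * \<bar>F k y\<bar> \<le> C * B" if "y \<in> Q" for y
    using K F[OF that] by (intro mult_mono) (auto intro: order_trans[OF abs_ge_zero])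
  then show "AE y in lborel. norm (indicator Q y * (K k (x - y) * F k y)) \<le> indicator Q y * (C * B)"
    by (auto simp: indicator_def abs_mult)
qed simp

text \<open>The centred Gaussian density with covariance matrix \<open>\<sigma>\<^sup>2 I\<close>.\<close>

definition gaussian :: "real \<Rightarrow> real^'n::finite \<Rightarrow> real" where
  "gaussian \<sigma> x = (\<Prod>i\<in>UNIV. normal_density 0 \<sigma> (x $ i))"

lemma unimodal_kernel_normal_density:
  assumes "0 < \<sigma>"
  shows "unimodal_kernel (normal_density 0 \<sigma>) (\<lambda>u. - u / \<sigma>\<^sup>2 * normal_density 0 \<sigma> u)
    (\<lambda>u. (u\<^sup>2 / \<sigma>^4 - 1 / \<sigma>\<^sup>2) * normal_density 0 \<sigma> u)"
proof
  show d: "(normal_density 0 \<sigma> has_real_derivative - u / \<sigma>\<^sup>2 * normal_density 0 \<sigma> u) (at u)" for u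
    unfolding normal_density_def using assms
    by (auto intro!: derivative_eq_intros simp: field_simps)
  show "((\<lambda>u. - u / \<sigma>\<^sup>2 * normal_density 0 \<sigma> u) has_real_derivative
      (u\<^sup>2 / \<sigma>^4 - 1 / \<sigma>\<^sup>2) * normal_density 0 \<sigma> u) (at u)" for u
    using assms
    by (auto intro!: derivative_eq_intros d simp: field_simps power2_eq_square power4_eq_xxxx)
  show "continuous_on UNIV (\<lambda>u. (u\<^sup>2 / \<sigma>^4 - 1 / \<sigma>\<^sup>2) * normal_density 0 \<sigma> u)"
    unfolding normal_density_def using assms by (intro continuous_intros) auto
  show "- u / \<sigma>\<^sup>2 * normal_density 0 \<sigma> u \<le> 0" if "0 \<le> u" for u
    using that by (simp add: mult_nonneg_nonneg)
qed (simp_all add: normal_density_def)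

lemma normal_density_le:
  assumes "0 < \<sigma>"
  shows "normal_density 0 \<sigma> u \<le> normal_density 0 \<sigma> 0"
  using unimodal_kernel.antimono_abs[OF unimodal_kernel_normal_density[OF assms], of 0 u] by simp

lemma gaussian_bounded:
  fixes x :: "real^'n::finite"
  assumes "0 < \<sigma>"
  shows "\<bar>gaussian \<sigma> x\<bar> \<le> (\<Prod>i\<in>(UNIV::'n::finite set). normal_density 0 \<sigma> 0)"
  unfolding gaussian_def abs_prod
  by (intro prod_mono) (auto simp: normal_density_le[OF assms])

lemma gaussian_measurable [measurable]: "gaussian \<sigma> \<in> borel_measurable borel"
  unfolding gaussian_def[abs_def] by measurable

lemma integral_indicator_open_interval:
  fixes h :: "real \<Rightarrow> real"
  assumes "continuous_on {-a..a} h"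
  shows "integrable lborel (\<lambda>y. indicator {-a<..<a} y * h y)"
    and "(\<integral>y. indicator {-a<..<a} y * h y \<partial>lborel) = integral {-a..a} h"
proof -
  have c: "set_integrable lborel {-a..a} h"
    by (rule borel_integrable_atLeastAtMost'[OF assms])
  then have o: "set_integrable lborel {-a<..<a} h"
    by (rule set_integrable_subset) auto
  then show "integrable lborel (\<lambda>y. indicator {-a<..<a} y * h y)"
    by (simp add: set_integrable_def)
  have "(\<integral>y. indicator {-a<..<a} y * h y \<partial>lborel) = integral {-a<..<a} h"
    using set_borel_integral_eq_integral(2)[OF o] by (simp add: set_lebesgue_integral_def)
  then show "(\<integral>y. indicator {-a<..<a} y * h y \<partial>lborel) = integral {-a..a} h"
    by (simp add: integral_open_interval_real)
qed

text \<open>Box and density are both products over the coordinates, so on a product of profiles the operator factors into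
one-dimensional convolutions.\<close>

lemma mid_cone_gaussian_step:
  fixes a :: "real^'n::finite"
  assumes \<sigma>: "0 < \<sigma>" and a: "\<And>i. 0 < a $ i" and F: "mid_cone a F"
  shows "mid_cone a (killed_step (box (- a) a) (gaussian \<sigma>) F)"
  using F
proof (induction rule: mid_cone.induct)
  case (product f)
  interpret k: unimodal_kernel "normal_density 0 \<sigma>" "\<lambda>u. - u / \<sigma>\<^sup>2 * normal_density 0 \<sigma> u"
    "\<lambda>u. (u\<^sup>2 / \<sigma>^4 - 1 / \<sigma>\<^sup>2) * normal_density 0 \<sigma> u"
    by (rule unimodal_kernel_normal_density[OF \<sigma>])
  let ?h = "\<lambda>i x y. normal_density 0 \<sigma> (x - y) * f i y"
  have c: "continuous_on S (?h i x)" for S i x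
    by (intro continuous_intros continuous_on_compose2[OF k.cont] axis_profile_continuous[OF product]) auto
  have "killed_step (box (- a) a) (gaussian \<sigma>) (\<lambda>x. \<Prod>i\<in>UNIV. f i (x $ i)) x =
      (\<Prod>i\<in>UNIV. integral {- (a $ i)..a $ i} (?h i (x $ i)))" for x
  proof -
    have "indicator (box (- a) a) y = (\<Prod>i\<in>UNIV. indicator {- (a $ i)<..<a $ i} (y $ i) :: real)" for y
      by (auto simp: indicator_def mem_box_cart prod_zero_iff)
    then have "killed_step (box (- a) a) (gaussian \<sigma>) (\<lambda>x. \<Prod>i\<in>UNIV. f i (x $ i)) x =
        (\<integral>y. (\<Prod>i\<in>UNIV. indicator {- (a $ i)<..<a $ i} (y $ i) * ?h i (x $ i) (y $ i)) \<partial>lborel)"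
      unfolding killed_step_def gaussian_def by (simp add: prod.distrib)
    also have "\<dots> = (\<Prod>i\<in>UNIV. integral {- (a $ i)..a $ i} (?h i (x $ i)))"
      by (subst integral_prod_cart(2)) (simp_all add: integral_indicator_open_interval c)
    finally show ?thesis .
  qed
  then have "killed_step (box (- a) a) (gaussian \<sigma>) (\<lambda>x. \<Prod>i\<in>UNIV. f i (x $ i)) =
      (\<lambda>x. \<Prod>i\<in>UNIV. (\<lambda>u. integral {- (a $ i)..a $ i} (?h i u)) (x $ i))" by auto
  then show ?case
    by (simp only:) (intro mid_cone.product k.axis_profile_convolution a product)
next
  case (add F G)
  obtain B C where "\<And>x. x \<in> box (- a) a \<Longrightarrow> \<bar>F x\<bar> \<le> B" "\<And>x. x \<in> box (- a) a \<Longrightarrow> \<bar>G x\<bar> \<le> C"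
    using mid_cone_bounded[OF add.hyps(1)] mid_cone_bounded[OF add.hyps(2)] by metis
  then have "killed_step (box (- a) a) (gaussian \<sigma>) (\<lambda>x. F x + G x) =
      (\<lambda>x. killed_step (box (- a) a) (gaussian \<sigma>) F x + killed_step (box (- a) a) (gaussian \<sigma>) G x)"
    using mid_cone_measurable[OF add.hyps(1)] mid_cone_measurable[OF add.hyps(2)]
    unfolding killed_step_def distrib_left
    by (intro ext Bochner_Integration.integral_add integrable_killed_step)
      (auto intro: gaussian_bounded[OF \<sigma>])
  then show ?case using mid_cone.add[OF add.IH] by simp
next
  case (scale F c)
  have "killed_step (box (- a) a) (gaussian \<sigma>) (\<lambda>x. c * F x) =
      (\<lambda>x. c * killed_step (box (- a) a) (gaussian \<sigma>) F x)"
    unfolding killed_step_def mult.left_commute[of _ c] by simp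
  then show ?case using mid_cone.scale[OF scale.IH scale.hyps(2)] by simp
next
  case (limit F B G)
  note [measurable] = limit.hyps(1)[THEN mid_cone_measurable]
  show ?case
  proof (rule mid_cone.limit[OF limit.IH])
    show "(\<lambda>k. killed_step (box (- a) a) (gaussian \<sigma>) (F k) x) \<longlonglongrightarrow>
        killed_step (box (- a) a) (gaussian \<sigma>) G x" for x
      by (rule killed_step_tendsto[OF _ _ _ _ gaussian_bounded[OF \<sigma>] limit.hyps(2) tendsto_const limit.hyps(3)])
        auto
    show "\<bar>killed_step (box (- a) a) (gaussian \<sigma>) (F k) x\<bar> \<le>
        (\<Prod>i\<in>(UNIV::'n set). normal_density 0 \<sigma> 0) * B * measure lborel (box (- a) a)" for k x
      by (rule killed_step_bounded[OF _ _ _ _ gaussian_bounded[OF \<sigma>] limit.hyps(2)]) auto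
  qed
qed

section \<open>Fourier kernels\<close>

text \<open>The inverse Fourier transform of an even function, written with the cosine so that it is real.\<close>

definition fourier_kernel :: "(real^'n::finite \<Rightarrow> real) \<Rightarrow> real^'n \<Rightarrow> real" where
  "fourier_kernel \<psi> x = (\<integral>\<xi>. cos (\<xi> \<bullet> x) * \<psi> \<xi> \<partial>lborel) / (2 * pi) ^ CARD('n)"

lemma integrable_cos_mult:
  fixes \<psi> :: "real^'n::finite \<Rightarrow> real"
  assumes "integrable lborel \<psi>"
  shows "integrable lborel (\<lambda>\<xi>. cos (\<xi> \<bullet> x) * \<psi> \<xi>)"
proof (rule Bochner_Integration.integrable_bound[OF assms])
  show "(\<lambda>\<xi>. cos (\<xi> \<bullet> x) * \<psi> \<xi>) \<in> borel_measurable lborel"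
    using borel_measurable_integrable[OF assms] by simp
  show "AE \<xi> in lborel. norm (cos (\<xi> \<bullet> x) * \<psi> \<xi>) \<le> norm (\<psi> \<xi>)"
    by (auto simp: abs_mult intro!: mult_left_le_one_le)
qed

lemma fourier_kernel_bounded:
  fixes \<psi> :: "real^'n::finite \<Rightarrow> real"
  assumes "integrable lborel \<psi>"
  shows "\<bar>fourier_kernel \<psi> x\<bar> \<le> (\<integral>\<xi>. \<bar>\<psi> \<xi>\<bar> \<partial>lborel) / (2 * pi) ^ CARD('n)"
proof -
  have "\<bar>\<integral>\<xi>. cos (\<xi> \<bullet> x) * \<psi> \<xi> \<partial>lborel\<bar> \<le> (\<integral>\<xi>. \<bar>cos (\<xi> \<bullet> x) * \<psi> \<xi>\<bar> \<partial>lborel)"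
    by (rule integral_abs_bound)
  also have "\<dots> \<le> (\<integral>\<xi>. \<bar>\<psi> \<xi>\<bar> \<partial>lborel)"
    by (intro integral_mono integrable_abs integrable_cos_mult assms)
      (auto simp: abs_mult intro!: mult_left_le_one_le)
  finally show ?thesis
    unfolding fourier_kernel_def by (simp add: divide_right_mono abs_divide)
qed

lemma fourier_kernel_measurable [measurable]:
  fixes \<psi> :: "real^'n::finite \<Rightarrow> real"
  assumes [measurable]: "\<psi> \<in> borel_measurable borel"
  shows "fourier_kernel \<psi> \<in> borel_measurable borel"
  unfolding fourier_kernel_def[abs_def] by measurable

lemma fourier_kernel_uminus: "fourier_kernel \<psi> (- x) = fourier_kernel \<psi> x"
  unfolding fourier_kernel_def by simp

lemma fourier_kernel_tendsto:
  fixes \<psi> :: "nat \<Rightarrow> real^'n::finite \<Rightarrow> real"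
  assumes "\<And>k. \<psi> k \<in> borel_measurable borel" "\<psi>' \<in> borel_measurable borel" "integrable lborel w"
    and "AE \<xi> in lborel. (\<lambda>k. \<psi> k \<xi>) \<longlonglongrightarrow> \<psi>' \<xi>"
    and "\<And>k. AE \<xi> in lborel. \<bar>\<psi> k \<xi>\<bar> \<le> w \<xi>"
  shows "(\<lambda>k. fourier_kernel (\<psi> k) x) \<longlonglongrightarrow> fourier_kernel \<psi>' x"
  unfolding fourier_kernel_def
proof (intro tendsto_divide tendsto_const integral_dominated_convergence[where w = w])
  show "AE \<xi> in lborel. (\<lambda>k. cos (\<xi> \<bullet> x) * \<psi> k \<xi>) \<longlonglongrightarrow> cos (\<xi> \<bullet> x) * \<psi>' \<xi>"
    using assms(4) by eventually_elim (intro tendsto_intros)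
  show "AE \<xi> in lborel. norm (cos (\<xi> \<bullet> x) * \<psi> k \<xi>) \<le> w \<xi>" for k
    using assms(5)[of k]
    by eventually_elim (auto simp: abs_mult intro: order_trans[OF mult_left_le_one_le])
qed (use assms in auto)

lemma fourier_exp_square:
  assumes "0 < \<tau>"
  shows "integrable lborel (\<lambda>\<xi>. iexp (\<xi> * u) * complex_of_real (exp (- \<tau> * \<xi>\<^sup>2)))" (is "integrable _ ?g")
    and "(\<integral>\<xi>. iexp (\<xi> * u) * complex_of_real (exp (- \<tau> * \<xi>\<^sup>2)) \<partial>lborel) =
      complex_of_real (2 * pi * normal_density 0 (sqrt (2 * \<tau>)) u)"
proof -
  \<comment> \<open>The substitution \<open>\<xi> = c x\<close> leads to the characteristic function of the standard normal law.\<close>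
  define c where "c = 1 / sqrt (2 * \<tau>)"
  have c: "0 < c" "c\<^sup>2 = 1 / (2 * \<tau>)" unfolding c_def using assms by (auto simp: power_divide)
  have g_scaled: "?g (0 + c * x) = complex_of_real (sqrt (2 * pi)) * (iexp (u * c * x) * std_normal_density x)" for x
  proof -
    have "\<tau> * (c * x)\<^sup>2 = x\<^sup>2 / 2" using c assms by (simp add: power_mult_distrib)
    then show ?thesis by (simp add: std_normal_density_def mult_ac)
  qed
  have "complex_of_real (exp (- ((u * c)\<^sup>2) / 2)) = char std_normal_distribution (u * c)"
    by (simp add: char_std_normal_distribution)
  also have "\<dots> = (\<integral>x. std_normal_density x *\<^sub>R iexp (u * c * x) \<partial>lborel)"
    unfolding char_def by (subst integral_density) (auto simp: normal_density_nonneg)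
  finally have char: "(\<integral>x. iexp (u * c * x) * std_normal_density x \<partial>lborel) = complex_of_real (exp (- ((u * c)\<^sup>2) / 2))"
    by (simp add: scaleR_conv_of_real mult.commute)
  have "integrable lborel (\<lambda>x. iexp (u * c * x) * std_normal_density x)"
    by (rule Bochner_Integration.integrable_bound[where f = std_normal_density])
      (auto simp: norm_mult integrable_normal_density)
  then have "integrable lborel (\<lambda>x. ?g (0 + c * x))"
    unfolding g_scaled by simp
  then show "integrable lborel ?g"
    using c lborel_integrable_real_affine_iff[of c ?g 0] by simp
  have "integral\<^sup>L lborel ?g = \<bar>c\<bar> *\<^sub>R (\<integral>x. ?g (0 + c * x) \<partial>lborel)"
    using c by (intro lborel_integral_real_affine) simp
  also have "\<dots> = complex_of_real (c * sqrt (2 * pi) * exp (- ((u * c)\<^sup>2) / 2))"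
    unfolding g_scaled using c
    by (simp only: integral_mult_right_zero char) (simp add: scaleR_conv_of_real)
  also have "c * sqrt (2 * pi) * exp (- ((u * c)\<^sup>2) / 2) = 2 * pi * normal_density 0 (sqrt (2 * \<tau>)) u"
  proof -
    have "c * sqrt (2 * pi) = sqrt (pi / \<tau>)"
      unfolding c_def by (simp add: real_sqrt_divide[symmetric] real_sqrt_mult[symmetric])
    moreover have "2 * pi / sqrt (2 * pi * (sqrt (2 * \<tau>))\<^sup>2) = sqrt (pi / \<tau>)"
    proof -
      have "2 * pi / sqrt (2 * pi * (sqrt (2 * \<tau>))\<^sup>2) = sqrt ((2 * pi)\<^sup>2) / sqrt (2 * pi * (2 * \<tau>))"
        using assms by (simp only: real_sqrt_abs real_sqrt_pow2) simp
      also have "\<dots> = sqrt (pi / \<tau>)"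
        unfolding real_sqrt_divide[symmetric] using assms by (simp add: power2_eq_square)
      finally show ?thesis .
    qed
    moreover have "(u * c)\<^sup>2 / 2 = (u - 0)\<^sup>2 / (2 * (sqrt (2 * \<tau>))\<^sup>2)"
      using assms c by (simp add: power_mult_distrib)
    moreover have "2 * pi * normal_density 0 (sqrt (2 * \<tau>)) u =
        2 * pi / sqrt (2 * pi * (sqrt (2 * \<tau>))\<^sup>2) * exp (- ((u - 0)\<^sup>2 / (2 * (sqrt (2 * \<tau>))\<^sup>2)))"
      unfolding normal_density_def by simp
    ultimately show ?thesis by (simp only: minus_divide_left[symmetric])
  qed
  finally show "integral\<^sup>L lborel ?g = complex_of_real (2 * pi * normal_density 0 (sqrt (2 * \<tau>)) u)" .
qed

lemma norm_square_cart: "(norm \<xi>)\<^sup>2 = (\<Sum>i\<in>UNIV. (\<xi> $ i)\<^sup>2)" for \<xi> :: "real^'n::finite"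
  by (simp add: norm_vec_def L2_set_def sum_nonneg)

lemma exp_norm_square_cart:
  "exp (- \<tau> * (norm \<xi>)\<^sup>2) = (\<Prod>i\<in>UNIV. exp (- \<tau> * (\<xi> $ i)\<^sup>2))" for \<xi> :: "real^'n::finite"
  unfolding norm_square_cart sum_distrib_left by (rule exp_sum) simp

lemma fourier_exp_norm_square:
  fixes x :: "real^'n::finite"
  assumes "0 < \<tau>"
  shows "integrable lborel (\<lambda>\<xi>::real^'n. iexp (\<xi> \<bullet> x) * complex_of_real (exp (- \<tau> * (norm \<xi>)\<^sup>2)))"
    and "(\<integral>\<xi>. iexp (\<xi> \<bullet> x) * complex_of_real (exp (- \<tau> * (norm \<xi>)\<^sup>2)) \<partial>(lborel :: (real^'n) measure)) =
      complex_of_real ((2 * pi) ^ CARD('n) * gaussian (sqrt (2 * \<tau>)) x)"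
proof -
  have prod: "iexp (\<xi> \<bullet> x) * complex_of_real (exp (- \<tau> * (norm \<xi>)\<^sup>2)) =
      (\<Prod>i\<in>UNIV. iexp (\<xi> $ i * x $ i) * complex_of_real (exp (- \<tau> * (\<xi> $ i)\<^sup>2)))" for \<xi> :: "real^'n"
    unfolding exp_norm_square_cart prod.distrib of_real_prod inner_vec_def of_real_sum sum_distrib_left
    by (simp add: exp_sum)
  show "integrable lborel (\<lambda>\<xi>::real^'n. iexp (\<xi> \<bullet> x) * complex_of_real (exp (- \<tau> * (norm \<xi>)\<^sup>2)))"
    unfolding prod by (intro integral_prod_cart(1) fourier_exp_square(1) assms)
  show "(\<integral>\<xi>. iexp (\<xi> \<bullet> x) * complex_of_real (exp (- \<tau> * (norm \<xi>)\<^sup>2)) \<partial>(lborel :: (real^'n) measure)) =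
      complex_of_real ((2 * pi) ^ CARD('n) * gaussian (sqrt (2 * \<tau>)) x)"
    unfolding prod
    by (subst integral_prod_cart(2)[OF fourier_exp_square(1)[OF assms]])
      (simp only: fourier_exp_square(2)[OF assms] gaussian_def of_real_prod[symmetric] prod.distrib
        prod_constant power_mult_distrib)
qed

lemma integrable_exp_norm_square:
  assumes "0 < \<tau>"
  shows "integrable lborel (\<lambda>\<xi>::real^'n::finite. exp (- \<tau> * (norm \<xi>)\<^sup>2))"
  using integrable_norm[OF fourier_exp_norm_square(1)[OF assms, of "0::real^'n"]] by (simp add: norm_mult)

text \<open>An exponential in \<open>|\<xi>|\<^sup>2\<close> belongs to a Gaussian kernel. This is the link between mixtures of exponentials and
mixtures of Gaussian densities.\<close>

lemma fourier_kernel_exp_norm_square: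
  assumes "0 < \<tau>"
  shows "fourier_kernel (\<lambda>\<xi>::real^'n::finite. exp (- \<tau> * (norm \<xi>)\<^sup>2)) = gaussian (sqrt (2 * \<tau>))"
proof
  fix x :: "real^'n"
  have "(\<integral>\<xi>. cos (\<xi> \<bullet> x) * exp (- \<tau> * (norm \<xi>)\<^sup>2) \<partial>(lborel :: (real^'n) measure)) =
      (\<integral>\<xi>. Re (iexp (\<xi> \<bullet> x) * complex_of_real (exp (- \<tau> * (norm \<xi>)\<^sup>2))) \<partial>(lborel :: (real^'n) measure))"
    by (simp add: cis_conv_exp[symmetric] del: of_real_exp)
  also have "\<dots> = (2 * pi) ^ CARD('n) * gaussian (sqrt (2 * \<tau>)) x"
    by (simp only: integral_Re[OF fourier_exp_norm_square(1)[OF assms]] fourier_exp_norm_square(2)[OF assms]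
        Re_complex_of_real)
  finally show "fourier_kernel (\<lambda>\<xi>. exp (- \<tau> * (norm \<xi>)\<^sup>2)) x = gaussian (sqrt (2 * \<tau>)) x"
    unfolding fourier_kernel_def by simp
qed

section \<open>Mixtures of exponentials\<close>

text \<open>On \<open>l > 0\<close> these are the Laplace transforms of finite measures on the nonnegative half-line, generated without mentioning measures: by
Bernstein's theorem, the bounded completely monotone functions. The point \<open>l = 0\<close> is left out of the limits since
it corresponds to the null set \<open>\<xi> = 0\<close> and convergence there would need an extra argument; measurability of
the limit has to be demanded because nothing is said about \<open>l \<le> 0\<close>.\<close>

inductive laplace_mixture :: "(real \<Rightarrow> real) \<Rightarrow> bool" where
  exp: "0 \<le> s \<Longrightarrow> laplace_mixture (\<lambda>l. exp (- s * l))"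
| add: "laplace_mixture \<phi> \<Longrightarrow> laplace_mixture \<psi> \<Longrightarrow> laplace_mixture (\<lambda>l. \<phi> l + \<psi> l)"
| scale: "laplace_mixture \<phi> \<Longrightarrow> 0 \<le> c \<Longrightarrow> laplace_mixture (\<lambda>l. c * \<phi> l)"
| limit: "(\<And>k. laplace_mixture (\<phi> k)) \<Longrightarrow> (\<And>k l. 0 < l \<Longrightarrow> \<phi> k l \<le> B) \<Longrightarrow>
    (\<And>l. 0 < l \<Longrightarrow> (\<lambda>k. \<phi> k l) \<longlonglongrightarrow> \<psi> l) \<Longrightarrow> \<psi> \<in> borel_measurable borel \<Longrightarrow> laplace_mixture \<psi>"

lemma laplace_mixture_measurable [measurable_dest]:
  "laplace_mixture \<phi> \<Longrightarrow> \<phi> \<in> borel_measurable borel"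
  by (induction rule: laplace_mixture.induct) auto

lemma laplace_mixture_nonneg: "laplace_mixture \<phi> \<Longrightarrow> 0 < l \<Longrightarrow> 0 \<le> \<phi> l"
proof (induction rule: laplace_mixture.induct)
  case (limit \<phi> B \<psi>)
  then show ?case by (intro LIMSEQ_le_const[OF limit.hyps(3)]) auto
qed auto

lemma laplace_mixture_bounded:
  assumes "laplace_mixture \<phi>"
  obtains B where "\<And>l. 0 < l \<Longrightarrow> \<phi> l \<le> B"
proof -
  have "\<exists>B. \<forall>l>0. \<phi> l \<le> B"
    using assms
  proof (induction rule: laplace_mixture.induct)
    case (exp s)
    then show ?case by (intro exI[of _ 1]) auto
  next
    case (add \<phi> \<psi>)
    then obtain B C where "\<forall>l>0. \<phi> l \<le> B" "\<forall>l>0. \<psi> l \<le> C" by blast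
    then have "\<forall>l>0. \<phi> l + \<psi> l \<le> B + C" by (auto intro: add_mono)
    then show ?case by blast
  next
    case (scale \<phi> c)
    then obtain B where "\<forall>l>0. \<phi> l \<le> B" by blast
    then have "\<forall>l>0. c * \<phi> l \<le> c * B" using scale.hyps by (auto intro: mult_left_mono)
    then show ?case by blast
  next
    case (limit \<phi> B \<psi>)
    have "\<psi> l \<le> B" if "0 < l" for l
      by (rule LIMSEQ_le_const2[OF limit.hyps(3)[OF that]]) (use limit.hyps(2)[OF that] in auto)
    then show ?case by blast
  qed
  then show ?thesis using that by blast
qed

lemma laplace_mixture_const: "0 \<le> c \<Longrightarrow> laplace_mixture (\<lambda>_. c)"
  using laplace_mixture.scale[OF laplace_mixture.exp[of 0]] by simp

lemma laplace_mixture_sum: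
  "(\<And>i. i \<in> I \<Longrightarrow> laplace_mixture (\<phi> i)) \<Longrightarrow> laplace_mixture (\<lambda>l. \<Sum>i\<in>I. \<phi> i l)"
proof (induction I rule: infinite_finite_induct)
  case (insert i I)
  then show ?case using laplace_mixture.add[of "\<phi> i" "\<lambda>l. \<Sum>i\<in>I. \<phi> i l"] by simp
qed (simp_all add: laplace_mixture_const)

lemma laplace_mixture_mult:
  assumes "laplace_mixture \<phi>" "laplace_mixture \<psi>"
  shows "laplace_mixture (\<lambda>l. \<phi> l * \<psi> l)"
  using assms(2)
proof (induction rule: laplace_mixture.induct)
  case (exp s)
  show ?case using assms(1)
  proof (induction rule: laplace_mixture.induct)
    case (exp r)
    then show ?case using laplace_mixture.exp[of "r + s"] \<open>0 \<le> s\<close>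
      by (simp add: exp_add[symmetric] algebra_simps)
  next
    case (add \<phi> \<psi>)
    then show ?case using laplace_mixture.add by (simp add: distrib_right)
  next
    case (scale \<phi> c)
    then show ?case using laplace_mixture.scale by (simp add: mult.assoc)
  next
    case (limit \<phi> B \<rho>)
    show ?case
    proof (rule laplace_mixture.limit[OF limit.IH])
      fix l :: real assume l: "0 < l"
      show "(\<lambda>k. \<phi> k l * exp (- s * l)) \<longlonglongrightarrow> \<rho> l * exp (- s * l)"
        by (intro tendsto_intros limit.hyps l)
    next
      fix k and l :: real assume l: "0 < l"
      have "\<phi> k l * exp (- s * l) \<le> \<phi> k l * 1"
        using laplace_mixture_nonneg[OF limit.hyps(1) l] \<open>0 \<le> s\<close> l by (intro mult_left_mono) auto
      then show "\<phi> k l * exp (- s * l) \<le> B" using limit.hyps(2)[OF l, of k] by simp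
    next
      show "(\<lambda>l. \<rho> l * exp (- s * l)) \<in> borel_measurable borel"
        using limit.hyps(4) by measurable
    qed
  qed
next
  case (add \<psi> \<rho>)
  then show ?case using laplace_mixture.add by (simp add: distrib_left)
next
  case (scale \<psi> c)
  then show ?case using laplace_mixture.scale by (simp add: mult.left_commute)
next
  case (limit \<psi> B \<rho>)
  obtain C where C: "\<And>l. 0 < l \<Longrightarrow> \<phi> l \<le> C" using laplace_mixture_bounded[OF assms(1)] by blast
  show ?case
  proof (rule laplace_mixture.limit[OF limit.IH])
    fix l :: real assume l: "0 < l"
    show "(\<lambda>k. \<phi> l * \<psi> k l) \<longlonglongrightarrow> \<phi> l * \<rho> l"
      by (intro tendsto_intros limit.hyps l)
  next
    fix k and l :: real assume l: "0 < l"
    show "\<phi> l * \<psi> k l \<le> C * B"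
      using C[OF l] limit.hyps(2)[OF l, of k] laplace_mixture_nonneg[OF assms(1) l]
        laplace_mixture_nonneg[OF limit.hyps(1) l, of k]
      by (intro mult_mono) auto
  next
    show "(\<lambda>l. \<phi> l * \<rho> l) \<in> borel_measurable borel"
      using limit.hyps(4) assms(1) by measurable
  qed
qed

lemma laplace_mixture_exp_of:
  assumes "laplace_mixture \<phi>"
  shows "laplace_mixture (\<lambda>l. exp (\<phi> l))"
proof -
  obtain B where B: "\<And>l. 0 < l \<Longrightarrow> \<phi> l \<le> B" using laplace_mixture_bounded[OF assms] by blast
  have power: "laplace_mixture (\<lambda>l. \<phi> l ^ k)" for k
    by (induction k) (auto intro: laplace_mixture_const laplace_mixture_mult[OF assms])
  show ?thesis
  proof (rule laplace_mixture.limit)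
    show "laplace_mixture (\<lambda>l. \<Sum>k<N. (1 / fact k) * \<phi> l ^ k)" for N
      by (intro laplace_mixture_sum laplace_mixture.scale power) auto
    fix l :: real assume l: "0 < l"
    have sums: "(\<lambda>k. 1 / fact k * \<phi> l ^ k) sums exp (\<phi> l)"
      using exp_converges[of "\<phi> l"] by (simp add: field_simps)
    then show "(\<lambda>N. \<Sum>k<N. (1 / fact k) * \<phi> l ^ k) \<longlonglongrightarrow> exp (\<phi> l)"
      by (simp add: sums_def)
    fix N
    have "(\<Sum>k<N. (1 / fact k) * \<phi> l ^ k) \<le> exp (\<phi> l)"
      unfolding sums_unique[OF sums] using laplace_mixture_nonneg[OF assms l]
      by (intro sum_le_suminf sums_summable[OF sums]) auto
    also have "\<dots> \<le> exp B" using B[OF l] by simp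
    finally show "(\<Sum>k<N. (1 / fact k) * \<phi> l ^ k) \<le> exp B" .
  qed (use assms in measurable)
qed

text \<open>All coefficients of \<open>1 - (1 - z)\<^sup>\<beta>\<close> as a power series in \<open>z\<close> are nonnegative: the Pochhammer factor starts with
\<open>-\<beta>\<close> and continues with positive terms.\<close>

lemma binomial_coeff_sign:
  assumes "0 \<le> \<beta>" "\<beta> < 1"
  shows "(- 1) ^ Suc k * (\<beta> gchoose Suc k) \<le> (0::real)"
proof -
  have "(- 1) ^ Suc k * (\<beta> gchoose Suc k) = ((-1)*(-1)) ^ Suc k * pochhammer (- \<beta>) (Suc k) / fact (Suc k)"
    unfolding power_mult_distrib by (simp add: gbinomial_pochhammer)
  also have "\<dots> = - (\<beta> * pochhammer (1 - \<beta>) k / fact (Suc k))"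
    by (simp add: pochhammer_rec)
  finally show ?thesis using assms pochhammer_nonneg[of "1 - \<beta>" k] by simp
qed

text \<open>With \<open>z = exp (-h l)\<close>, the exponent is \<open>-c\<close> plus \<open>c\<close> times a power series in \<open>z\<close> with nonnegative coefficients, whose partial sums are
bounded by 1, and powers of \<open>z\<close> are exponentials in \<open>l\<close>.\<close>

lemma laplace_mixture_exp_powr_one_minus_exp:
  assumes \<beta>: "0 \<le> \<beta>" "\<beta> < 1" and c: "0 \<le> c" and h: "0 < h"
  shows "laplace_mixture (\<lambda>l. exp (- c * (1 - exp (- h * l)) powr \<beta>))"
proof (rule laplace_mixture.limit)
  define b where "b k = - ((- 1) ^ Suc k * (\<beta> gchoose Suc k))" for k
  have b: "0 \<le> b k" for k unfolding b_def using binomial_coeff_sign[OF \<beta>, of k] by simp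
  define S where "S N l = (\<Sum>k<N. b k * exp (- h * l) ^ Suc k)" for N and l :: real
  have S: "laplace_mixture (S N)" for N
    unfolding S_def
  proof (intro laplace_mixture_sum laplace_mixture.scale b)
    have "exp (- h * l) ^ Suc k = exp (- (real (Suc k) * h) * l)" for k and l :: real
      unfolding exp_of_nat_mult[symmetric] by (simp only: mult_minus_left mult_minus_right mult.assoc)
    then show "laplace_mixture (\<lambda>l. exp (- h * l) ^ Suc k)" for k
      using laplace_mixture.exp[of "real (Suc k) * h"] h by simp
  qed
  show "laplace_mixture (\<lambda>l. exp (- c) * exp (c * S N l))" for N
    by (intro laplace_mixture.scale laplace_mixture_exp_of S c) auto
  fix l :: real assume l: "0 < l"
  define z where "z = exp (- h * l)"
  have z: "0 < z" "z < 1" unfolding z_def using h l by auto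
  have "(\<lambda>n. (\<beta> gchoose n) * (- z) ^ n) sums (1 + (- z)) powr \<beta>"
    using z by (intro gen_binomial_real) auto
  then have "(\<lambda>n. (\<beta> gchoose Suc n) * (- z) ^ Suc n) sums ((1 - z) powr \<beta> - 1)"
    by (subst sums_Suc_iff) simp
  then have "(\<lambda>n. - ((\<beta> gchoose Suc n) * (- z) ^ Suc n)) sums (- ((1 - z) powr \<beta> - 1))"
    by (rule sums_minus)
  moreover have "- ((\<beta> gchoose Suc n) * (- z) ^ Suc n) = b n * z ^ Suc n" for n
    unfolding b_def power_minus[of z] by simp
  ultimately have sums: "(\<lambda>n. b n * z ^ Suc n) sums (1 - (1 - z) powr \<beta>)" by (simp only: minus_diff_eq)
  have lim: "(\<lambda>N. S N l) \<longlonglongrightarrow> 1 - (1 - z) powr \<beta>"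
    using sums unfolding S_def z_def[symmetric] sums_def .
  then have "(\<lambda>N. exp (- c) * exp (c * S N l)) \<longlonglongrightarrow>
      exp (- c) * exp (c * (1 - (1 - z) powr \<beta>))"
    by (intro tendsto_intros)
  also have "exp (- c) * exp (c * (1 - (1 - z) powr \<beta>)) =
      exp (- c * (1 - z) powr \<beta>)"
    by (simp add: exp_add[symmetric] algebra_simps)
  finally show "(\<lambda>N. exp (- c) * exp (c * S N l)) \<longlonglongrightarrow>
      exp (- c * (1 - exp (- h * l)) powr \<beta>)"
    unfolding z_def .
  fix N
  have "S N l \<le> 1 - (1 - z) powr \<beta>"
    unfolding S_def z_def[symmetric] sums_unique[OF sums] using b z
    by (intro sum_le_suminf sums_summable[OF sums]) auto
  then have "S N l \<le> 1" by (smt (verit) powr_ge_zero)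
  then have "c * S N l \<le> c * 1" using c by (intro mult_left_mono) auto
  then show "exp (- c) * exp (c * S N l) \<le> 1"
    by (simp add: exp_add[symmetric])
qed measurable

text \<open>This is the existence of the one-sided stable subordinator of index \<open>\<beta>\<close>. It follows from the preceding lemma since
\<open>((1 - exp (-h l)) / h)\<^sup>\<beta>\<close> tends to \<open>l\<^sup>\<beta>\<close> as \<open>h\<close> tends to 0; this discretization avoids the integral representation of \<open>l\<^sup>\<beta>\<close>.\<close>

proposition laplace_mixture_exp_powr:
  assumes \<beta>: "0 \<le> \<beta>" "\<beta> \<le> 1" and t: "0 \<le> t"
  shows "laplace_mixture (\<lambda>l. exp (- t * l powr \<beta>))"
proof (cases "\<beta> = 1")
  case True
  show ?thesis
    by (rule laplace_mixture.limit[OF laplace_mixture.exp[OF t], where B = 1]) (use t True in auto)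
next
  case False
  define m where "m k = 1 / real (Suc k)" for k
  have m: "0 < m k" for k unfolding m_def by simp
  show ?thesis
  proof (rule laplace_mixture.limit)
    show "laplace_mixture (\<lambda>l. exp (- (t * (1 / m k) powr \<beta>) * (1 - exp (- m k * l)) powr \<beta>))" for k
      using \<beta> False t m by (intro laplace_mixture_exp_powr_one_minus_exp) auto
    fix l :: real assume l: "0 < l"
    have "((\<lambda>h. 1 - exp (- h * l)) has_real_derivative l) (at 0)"
      by (auto intro!: derivative_eq_intros)
    then have "((\<lambda>h. (1 - exp (- h * l)) / h) \<longlongrightarrow> l) (at 0)"
      by (simp add: DERIV_def)
    moreover have "filterlim m (at 0) sequentially"
      unfolding filterlim_at using m LIMSEQ_Suc[OF lim_1_over_n[where 'a=real]]
      by (auto simp: m_def[abs_def] less_imp_neq[THEN not_sym])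
    ultimately have "(\<lambda>k. (1 - exp (- m k * l)) / m k) \<longlonglongrightarrow> l"
      by (rule filterlim_compose)
    then have "(\<lambda>k. exp (- t * ((1 - exp (- m k * l)) / m k) powr \<beta>)) \<longlonglongrightarrow>
        exp (- t * l powr \<beta>)"
      using l by (intro tendsto_intros) auto
    moreover have "((1 - exp (- m k * l)) / m k) powr \<beta> =
        (1 / m k) powr \<beta> * (1 - exp (- m k * l)) powr \<beta>" for k
      using m[of k] l by (subst powr_mult[symmetric]) (auto simp: field_simps)
    ultimately show "(\<lambda>k. exp (- (t * (1 / m k) powr \<beta>) * (1 - exp (- m k * l)) powr \<beta>)) \<longlonglongrightarrow>
        exp (- t * l powr \<beta>)"
      by (simp add: mult.assoc)
    show "exp (- (t * (1 / m k) powr \<beta>) * (1 - exp (- m k * l)) powr \<beta>) \<le> 1" for k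
      using t by simp
  qed measurable
qed

section \<open>Stable steps preserve the cone\<close>

text \<open>The Gaussian factor makes the integrand integrable for every bounded \<open>\<phi>\<close>, with a bound that is uniform along limits. Probabilistically
it adds an independent Gaussian of variance \<open>2 \<epsilon>\<close> in each coordinate.\<close>

definition mixture_kernel :: "(real \<Rightarrow> real) \<Rightarrow> real \<Rightarrow> real^'n::finite \<Rightarrow> real" where
  "mixture_kernel \<phi> \<epsilon> = fourier_kernel (\<lambda>\<xi>. \<phi> ((norm \<xi>)\<^sup>2) * exp (- \<epsilon> * (norm \<xi>)\<^sup>2))"

lemma AE_lborel_nonzero: "AE \<xi> in lborel. \<xi> \<noteq> (0::'a::euclidean_space)"
  by (rule AE_lborel_singleton)

lemma mixture_kernel_measurable [measurable]:
  assumes [measurable]: "\<phi> \<in> borel_measurable borel"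
  shows "mixture_kernel \<phi> \<epsilon> \<in> borel_measurable borel"
  unfolding mixture_kernel_def by measurable

lemma integrable_mixture_kernel:
  assumes [measurable]: "\<phi> \<in> borel_measurable borel"
    and "\<And>l. 0 < l \<Longrightarrow> 0 \<le> \<phi> l" "\<And>l. 0 < l \<Longrightarrow> \<phi> l \<le> B" "0 < \<epsilon>"
  shows "integrable lborel (\<lambda>\<xi>::real^'n::finite. \<phi> ((norm \<xi>)\<^sup>2) * exp (- \<epsilon> * (norm \<xi>)\<^sup>2))"
    and "AE \<xi> in lborel. \<bar>\<phi> ((norm (\<xi>::real^'n))\<^sup>2) * exp (- \<epsilon> * (norm \<xi>)\<^sup>2)\<bar> \<le> B * exp (- \<epsilon> * (norm \<xi>)\<^sup>2)"
proof -
  show bd: "AE \<xi> in lborel. \<bar>\<phi> ((norm (\<xi>::real^'n))\<^sup>2) * exp (- \<epsilon> * (norm \<xi>)\<^sup>2)\<bar> \<le> B * exp (- \<epsilon> * (norm \<xi>)\<^sup>2)"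
    using AE_lborel_nonzero
  proof eventually_elim
    case (elim \<xi>)
    then show ?case using assms(2,3)[of "(norm \<xi>)\<^sup>2"] by (simp add: abs_mult)
  qed
  show "integrable lborel (\<lambda>\<xi>::real^'n::finite. \<phi> ((norm \<xi>)\<^sup>2) * exp (- \<epsilon> * (norm \<xi>)\<^sup>2))"
  proof (rule Bochner_Integration.integrable_bound)
    show "integrable lborel (\<lambda>\<xi>::real^'n. B * exp (- \<epsilon> * (norm \<xi>)\<^sup>2))"
      by (intro integrable_mult_right integrable_exp_norm_square assms)
    show "AE \<xi> in lborel. norm (\<phi> ((norm (\<xi>::real^'n))\<^sup>2) * exp (- \<epsilon> * (norm \<xi>)\<^sup>2)) \<le> norm (B * exp (- \<epsilon> * (norm \<xi>)\<^sup>2))"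
      using bd by eventually_elim simp
  qed measurable
qed

lemma mixture_kernel_bounded:
  assumes "\<phi> \<in> borel_measurable borel"
    and "\<And>l. 0 < l \<Longrightarrow> 0 \<le> \<phi> l" "\<And>l. 0 < l \<Longrightarrow> \<phi> l \<le> B" "0 < \<epsilon>"
  shows "\<bar>mixture_kernel \<phi> \<epsilon> (x::real^'n::finite)\<bar> \<le>
    (\<integral>\<xi>. B * exp (- \<epsilon> * (norm \<xi>)\<^sup>2) \<partial>(lborel :: (real^'n) measure)) / (2 * pi) ^ CARD('n)"
proof -
  have int: "integrable lborel (\<lambda>\<xi>::real^'n. \<phi> ((norm \<xi>)\<^sup>2) * exp (- \<epsilon> * (norm \<xi>)\<^sup>2))"
    "AE \<xi> in lborel. \<bar>\<phi> ((norm (\<xi>::real^'n))\<^sup>2) * exp (- \<epsilon> * (norm \<xi>)\<^sup>2)\<bar> \<le> B * exp (- \<epsilon> * (norm \<xi>)\<^sup>2)"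
    using assms integrable_mixture_kernel[of \<phi> B \<epsilon>] by auto
  have "(\<integral>\<xi>. \<bar>\<phi> ((norm \<xi>)\<^sup>2) * exp (- \<epsilon> * (norm \<xi>)\<^sup>2)\<bar> \<partial>(lborel :: (real^'n) measure)) \<le>
      (\<integral>\<xi>. B * exp (- \<epsilon> * (norm \<xi>)\<^sup>2) \<partial>(lborel :: (real^'n) measure))"
    by (rule integral_mono_AE[OF integrable_abs[OF int(1)]
          integrable_mult_right[OF integrable_exp_norm_square[OF assms(4)]] int(2)])
  then show ?thesis
    using fourier_kernel_bounded[OF int(1), of x] unfolding mixture_kernel_def
    by (auto elim!: order_trans intro: divide_right_mono)
qed

text \<open>For fixed \<open>F\<close> the operator is linear in \<open>\<phi>\<close> and continuous under bounded limits, so that the induction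
on \<open>\<phi>\<close> reduces the claim to a single exponential, whose kernel is Gaussian.\<close>

lemma mid_cone_mixture_step:
  fixes a :: "real^'n::finite"
  assumes \<phi>: "laplace_mixture \<phi>" and a: "\<And>i. 0 < a $ i" and F: "mid_cone a F" and \<epsilon>: "0 < \<epsilon>"
  shows "mid_cone a (killed_step (box (- a) a) (mixture_kernel \<phi> \<epsilon>) F)"
  using \<phi>
proof (induction rule: laplace_mixture.induct)
  case (exp s)
  have "mixture_kernel (\<lambda>l. exp (- s * l)) \<epsilon> = (gaussian (sqrt (2 * (s + \<epsilon>))) :: real^'n \<Rightarrow> real)"
    unfolding mixture_kernel_def using exp \<epsilon>
    by (subst fourier_kernel_exp_norm_square[symmetric]) (auto simp: exp_add[symmetric] algebra_simps)
  then show ?case using exp \<epsilon> by (simp add: mid_cone_gaussian_step a F)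
next
  case (add \<phi> \<psi>)
  obtain B C where B: "\<And>l. 0 < l \<Longrightarrow> \<phi> l \<le> B" and C: "\<And>l. 0 < l \<Longrightarrow> \<psi> l \<le> C"
    using laplace_mixture_bounded[OF add.hyps(1)] laplace_mixture_bounded[OF add.hyps(2)] by metis
  obtain M where M: "\<And>x. x \<in> box (- a) a \<Longrightarrow> \<bar>F x\<bar> \<le> M" using mid_cone_bounded[OF F] by blast
  note m = laplace_mixture_measurable[OF add.hyps(1)] laplace_mixture_measurable[OF add.hyps(2)]
  note [measurable] = m mid_cone_measurable[OF F]
  note n = laplace_mixture_nonneg[OF add.hyps(1)] laplace_mixture_nonneg[OF add.hyps(2)]
  have int: "integrable lborel (\<lambda>\<xi>::real^'n. \<phi> ((norm \<xi>)\<^sup>2) * exp (- \<epsilon> * (norm \<xi>)\<^sup>2))"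
    "integrable lborel (\<lambda>\<xi>::real^'n. \<psi> ((norm \<xi>)\<^sup>2) * exp (- \<epsilon> * (norm \<xi>)\<^sup>2))"
    using integrable_mixture_kernel(1)[OF m(1) _ _ \<epsilon>] integrable_mixture_kernel(1)[OF m(2) _ _ \<epsilon>] n B C
    by blast+
  have "mixture_kernel (\<lambda>l. \<phi> l + \<psi> l) \<epsilon> x = mixture_kernel \<phi> \<epsilon> x + mixture_kernel \<psi> \<epsilon> x" for x :: "real^'n"
    unfolding mixture_kernel_def fourier_kernel_def distrib_right distrib_left add_divide_distrib[symmetric]
    using int[THEN integrable_cos_mult, of x] by simp
  moreover have "killed_step (box (- a) a) (\<lambda>x. mixture_kernel \<phi> \<epsilon> x + mixture_kernel \<psi> \<epsilon> x) F x =
      killed_step (box (- a) a) (mixture_kernel \<phi> \<epsilon>) F x + killed_step (box (- a) a) (mixture_kernel \<psi> \<epsilon>) F x" for x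
  proof -
    have 1: "integrable lborel (\<lambda>y. indicator (box (- a) a) y * (mixture_kernel \<phi> \<epsilon> (x - y) * F y))"
      by (rule integrable_killed_step[OF _ _ _ _ mixture_kernel_bounded[OF m(1) _ _ \<epsilon>] M])
        (use n B in auto)
    have 2: "integrable lborel (\<lambda>y. indicator (box (- a) a) y * (mixture_kernel \<psi> \<epsilon> (x - y) * F y))"
      by (rule integrable_killed_step[OF _ _ _ _ mixture_kernel_bounded[OF m(2) _ _ \<epsilon>] M])
        (use n C in auto)
    show ?thesis
      unfolding killed_step_def
      by (subst Bochner_Integration.integral_add[OF 1 2, symmetric]) (simp add: algebra_simps)
  qed
  ultimately have "killed_step (box (- a) a) (mixture_kernel (\<lambda>l. \<phi> l + \<psi> l) \<epsilon>) F =
      (\<lambda>x. killed_step (box (- a) a) (mixture_kernel \<phi> \<epsilon>) F x + killed_step (box (- a) a) (mixture_kernel \<psi> \<epsilon>) F x)"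
    by (auto simp: killed_step_def)
  then show ?case using mid_cone.add[OF add.IH] by simp
next
  case (scale \<phi> c)
  have "mixture_kernel (\<lambda>l. c * \<phi> l) \<epsilon> x = c * mixture_kernel \<phi> \<epsilon> x" for x :: "real^'n"
    unfolding mixture_kernel_def fourier_kernel_def by (simp add: mult.left_commute mult.assoc)
  then have "killed_step (box (- a) a) (mixture_kernel (\<lambda>l. c * \<phi> l) \<epsilon>) F =
      (\<lambda>x. c * killed_step (box (- a) a) (mixture_kernel \<phi> \<epsilon>) F x)"
    unfolding killed_step_def by (simp add: mult.left_commute mult.assoc)
  then show ?case using mid_cone.scale[OF scale.IH scale.hyps(2)] by simp
next
  case (limit \<phi> B \<psi>)
  obtain M where M: "\<And>x. x \<in> box (- a) a \<Longrightarrow> \<bar>F x\<bar> \<le> M" using mid_cone_bounded[OF F] by blast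
  note m = laplace_mixture_measurable[OF limit.hyps(1)]
  note n = laplace_mixture_nonneg[OF limit.hyps(1)]
  note [measurable] = m limit.hyps(4) mid_cone_measurable[OF F]
  note bd = mixture_kernel_bounded[OF m n limit.hyps(2) \<epsilon>, where 'n='n]
  have lim: "(\<lambda>k. mixture_kernel (\<phi> k) \<epsilon> x) \<longlonglongrightarrow> mixture_kernel \<psi> \<epsilon> x" for x :: "real^'n"
    unfolding mixture_kernel_def
  proof (rule fourier_kernel_tendsto[where w = "\<lambda>\<xi>. B * exp (- \<epsilon> * (norm \<xi>)\<^sup>2)"])
    show "AE \<xi> in lborel. (\<lambda>k. \<phi> k ((norm (\<xi>::real^'n))\<^sup>2) * exp (- \<epsilon> * (norm \<xi>)\<^sup>2)) \<longlonglongrightarrow>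
        \<psi> ((norm \<xi>)\<^sup>2) * exp (- \<epsilon> * (norm \<xi>)\<^sup>2)"
      using AE_lborel_nonzero by eventually_elim (intro tendsto_intros limit.hyps(3), simp)
    show "AE \<xi> in lborel. \<bar>\<phi> k ((norm (\<xi>::real^'n))\<^sup>2) * exp (- \<epsilon> * (norm \<xi>)\<^sup>2)\<bar> \<le> B * exp (- \<epsilon> * (norm \<xi>)\<^sup>2)" for k
      by (rule integrable_mixture_kernel(2)[OF m _ _ \<epsilon>]) (use n limit.hyps(2) in auto)
    show "integrable lborel (\<lambda>\<xi>::real^'n. B * exp (- \<epsilon> * (norm \<xi>)\<^sup>2))"
      by (intro integrable_mult_right integrable_exp_norm_square \<epsilon>)
  qed measurable
  show ?case
  proof (rule mid_cone.limit[OF limit.IH])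
    show "(\<lambda>k. killed_step (box (- a) a) (mixture_kernel (\<phi> k) \<epsilon>) F x) \<longlonglongrightarrow>
        killed_step (box (- a) a) (mixture_kernel \<psi> \<epsilon>) F x" for x
      by (rule killed_step_tendsto[OF _ _ _ _ bd M lim tendsto_const]) auto
    show "\<bar>killed_step (box (- a) a) (mixture_kernel (\<phi> k) \<epsilon>) F x\<bar> \<le>
        (\<integral>\<xi>. B * exp (- \<epsilon> * (norm \<xi>)\<^sup>2) \<partial>(lborel :: (real^'n) measure)) / (2 * pi) ^ CARD('n) * M *
        measure lborel (box (- a) a)" for k x
      by (rule killed_step_bounded[OF _ _ _ _ bd M]) auto
  qed
qed

lemma power_le_exp:
  fixes y :: real
  assumes "0 \<le> y"
  shows "y ^ m \<le> fact m * exp y"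
proof -
  have sums: "(\<lambda>k. y ^ k / fact k) sums exp y"
    using exp_converges[of y] by (simp add: field_simps)
  have "(\<Sum>k\<in>{m}. y ^ k / fact k) \<le> exp y"
    unfolding sums_unique[OF sums] using assms by (intro sum_le_suminf sums_summable[OF sums]) auto
  then show ?thesis by (simp add: field_simps)
qed

lemma stretched_exp_dominates_powers:
  fixes t \<alpha> :: real
  assumes "0 < \<alpha>" "0 < t"
  obtains C where "\<And>r. 0 \<le> r \<Longrightarrow> (1 + r) ^ N * exp (- t * r powr \<alpha>) \<le> C"
proof -
  \<comment> \<open>So large that \<open>r\<^sup>N \<le> (r\<^sup>\<alpha>)\<^sup>m\<close> for \<open>r \<ge> 1\<close>.\<close>
  define m where "m = nat \<lceil>real N / \<alpha>\<rceil>"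
  have m: "real N \<le> \<alpha> * real m"
    using assms unfolding m_def by (metis divide_le_eq mult.commute real_nat_ceiling_ge)
  have "(1 + r) ^ N * exp (- t * r powr \<alpha>) \<le> 2 ^ N + 2 ^ N * fact m / t ^ m" if r: "0 \<le> r" for r
  proof (cases "r \<le> 1")
    case True
    have "(1 + r) ^ N * exp (- t * r powr \<alpha>) \<le> 2 ^ N * 1"
      using True r assms by (intro mult_mono power_mono) auto
    also have "\<dots> \<le> 2 ^ N + 2 ^ N * fact m / t ^ m" using assms by simp
    finally show ?thesis .
  next
    case False
    have "r ^ N = r powr real N" using False by (simp add: powr_realpow)
    also have "\<dots> \<le> r powr (\<alpha> * real m)" using m False by (intro powr_mono) auto
    also have "\<dots> = (r powr \<alpha>) ^ m"
      using False by (simp add: powr_powr[symmetric] powr_realpow)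
    finally have rN: "t ^ m * r ^ N \<le> (t * r powr \<alpha>) ^ m"
      using assms by (simp add: power_mult_distrib)
    also have "\<dots> \<le> fact m * exp (t * r powr \<alpha>)" using assms by (intro power_le_exp) auto
    finally have "r ^ N * exp (- t * r powr \<alpha>) \<le> fact m / t ^ m"
      using assms by (simp add: field_simps exp_minus)
    then have le: "2 ^ N * (r ^ N * exp (- t * r powr \<alpha>)) \<le> 2 ^ N * (fact m / t ^ m)"
      by (intro mult_left_mono) auto
    have "(1 + r) ^ N * exp (- t * r powr \<alpha>) \<le> (2 * r) ^ N * exp (- t * r powr \<alpha>)"
      using False by (intro mult_right_mono power_mono) auto
    also have "\<dots> = 2 ^ N * (r ^ N * exp (- t * r powr \<alpha>))" by (simp add: power_mult_distrib)
    also note le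
    also have "2 ^ N * (fact m / t ^ m) \<le> 2 ^ N + 2 ^ N * fact m / t ^ m" by simp
    finally show ?thesis .
  qed
  then show ?thesis using that by blast
qed

text \<open>The additional factor is needed to differentiate the stable kernel under the integral sign. A multiple of a product of
one-dimensional Cauchy densities serves as dominating function.\<close>

lemma integrable_moment_stretched_exp:
  fixes t \<alpha> :: real
  assumes "0 < \<alpha>" "0 < t"
  shows "integrable lborel (\<lambda>\<xi>::real^'n::finite. (1 + norm \<xi>) * exp (- t * norm \<xi> powr \<alpha>))"
proof -
  obtain C where C: "\<And>r. 0 \<le> r \<Longrightarrow> (1 + r) ^ (1 + 2 * CARD('n)) * exp (- t * r powr \<alpha>) \<le> C"
    using stretched_exp_dominates_powers[OF assms] by blast
  have cauchy: "integrable lborel (\<lambda>x::real. inverse (1 + x\<^sup>2))"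
    using integrable_inverse_1_plus_square by (simp add: set_integrable_def)
  show ?thesis
  proof (rule Bochner_Integration.integrable_bound)
    show "integrable lborel (\<lambda>\<xi>::real^'n. C * (\<Prod>i\<in>UNIV. inverse (1 + (\<xi> $ i)\<^sup>2)))"
      by (intro integrable_mult_right integral_prod_cart(1) cauchy)
    have "(1 + norm \<xi>) * exp (- t * norm \<xi> powr \<alpha>) \<le> C * (\<Prod>i\<in>UNIV. inverse (1 + (\<xi> $ i)\<^sup>2))" for \<xi> :: "real^'n"
    proof -
      have "(\<Prod>i\<in>UNIV. 1 + (\<xi> $ i)\<^sup>2) \<le> (\<Prod>i\<in>(UNIV::'n set). (1 + norm \<xi>)\<^sup>2)"
      proof (intro prod_mono conjI)
        fix i
        have "(\<xi> $ i)\<^sup>2 \<le> (norm \<xi>)\<^sup>2"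
          using component_le_norm_cart[of \<xi> i] by (simp add: abs_le_square_iff[symmetric])
        then show "1 + (\<xi> $ i)\<^sup>2 \<le> (1 + norm \<xi>)\<^sup>2" by (simp add: power2_sum add_increasing2)
      qed simp
      then have P: "(\<Prod>i\<in>UNIV. 1 + (\<xi> $ i)\<^sup>2) \<le> (1 + norm \<xi>) ^ (2 * CARD('n))" by (simp add: power_mult)
      have pos: "0 < (\<Prod>i\<in>UNIV. 1 + (\<xi> $ i)\<^sup>2)" by (intro prod_pos) (auto intro: add_pos_nonneg)
      have "(1 + norm \<xi>) * exp (- t * norm \<xi> powr \<alpha>) * (\<Prod>i\<in>UNIV. 1 + (\<xi> $ i)\<^sup>2) \<le>
          (1 + norm \<xi>) * exp (- t * norm \<xi> powr \<alpha>) * (1 + norm \<xi>) ^ (2 * CARD('n))"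
        by (intro mult_left_mono P) auto
      also have "\<dots> \<le> C" using C[of "norm \<xi>"] by (simp add: mult_ac)
      finally have "(1 + norm \<xi>) * exp (- t * norm \<xi> powr \<alpha>) \<le> C * inverse (\<Prod>i\<in>UNIV. 1 + (\<xi> $ i)\<^sup>2)"
        using pos by (simp add: divide_inverse[symmetric] pos_le_divide_eq)
      then show ?thesis using prod_inversef[of "\<lambda>i. 1 + (\<xi> $ i)\<^sup>2" UNIV] by (simp add: o_def)
    qed
    then show "AE \<xi> in lborel. norm ((1 + norm (\<xi>::real^'n)) * exp (- t * norm \<xi> powr \<alpha>)) \<le>
        norm (C * (\<Prod>i\<in>UNIV. inverse (1 + (\<xi> $ i)\<^sup>2)))"
      by (intro AE_I2) (smt (verit) real_norm_def exp_gt_zero mult_nonneg_nonneg norm_ge_zero)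
  qed measurable
qed

lemma integrable_stretched_exp:
  fixes t \<alpha> :: real
  assumes "0 < \<alpha>" "0 < t"
  shows "integrable lborel (\<lambda>\<xi>::real^'n::finite. exp (- t * norm \<xi> powr \<alpha>))"
  by (rule Bochner_Integration.integrable_bound[OF integrable_moment_stretched_exp[OF assms]]) auto

text \<open>The continuous version of the density of the symmetric stable law at time \<open>t\<close>.\<close>

definition stable_kernel :: "real \<Rightarrow> real \<Rightarrow> real^'n::finite \<Rightarrow> real" where
  "stable_kernel \<alpha> t = fourier_kernel (\<lambda>\<xi>. exp (- t * norm \<xi> powr \<alpha>))"

lemma stable_kernel_measurable [measurable]: "stable_kernel \<alpha> t \<in> borel_measurable borel"
  unfolding stable_kernel_def by measurable

lemma norm_square_powr: "(norm x)\<^sup>2 powr (\<alpha> / 2) = norm x powr \<alpha>"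
  by (cases "x = 0") (simp_all add: powr_powr powr_numeral[symmetric] del: powr_numeral)

lemma mixture_kernel_tendsto_stable_kernel:
  fixes x :: "real^'n::finite"
  assumes "0 < \<alpha>" "0 < t"
  shows "(\<lambda>k. mixture_kernel (\<lambda>l. exp (- t * l powr (\<alpha> / 2))) (1 / real (Suc k)) x) \<longlonglongrightarrow> stable_kernel \<alpha> t x"
  unfolding mixture_kernel_def stable_kernel_def norm_square_powr
proof (rule fourier_kernel_tendsto[OF _ _ integrable_stretched_exp[OF assms]])
  have "(\<lambda>k. exp (- t * norm \<xi> powr \<alpha>) * exp (- (1 / real (Suc k)) * (norm \<xi>)\<^sup>2)) \<longlonglongrightarrow>
      exp (- t * norm \<xi> powr \<alpha>) * exp (- 0 * (norm \<xi>)\<^sup>2)" for \<xi> :: "real^'n"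
    by (intro tendsto_intros LIMSEQ_Suc[OF lim_1_over_n])
  then show "AE \<xi>::real^'n in lborel. (\<lambda>k. exp (- t * norm \<xi> powr \<alpha>) * exp (- (1 / real (Suc k)) * (norm \<xi>)\<^sup>2)) \<longlonglongrightarrow>
      exp (- t * norm \<xi> powr \<alpha>)" by simp
qed (auto simp: abs_mult mult_le_one)

lemma mixture_kernel_le_stable:
  fixes x :: "real^'n::finite"
  assumes "0 < \<alpha>" "0 < t" "0 < \<epsilon>"
  shows "\<bar>mixture_kernel (\<lambda>l. exp (- t * l powr (\<alpha> / 2))) \<epsilon> x\<bar> \<le>
    (\<integral>\<xi>. exp (- t * norm \<xi> powr \<alpha>) \<partial>(lborel :: (real^'n) measure)) / (2 * pi) ^ CARD('n)"
proof -
  have int: "integrable lborel (\<lambda>\<xi>::real^'n. exp (- t * norm \<xi> powr \<alpha>) * exp (- \<epsilon> * (norm \<xi>)\<^sup>2))"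
    by (rule Bochner_Integration.integrable_bound[OF integrable_stretched_exp[OF assms(1,2)]])
      (use assms in auto)
  have "(\<integral>\<xi>. \<bar>exp (- t * norm \<xi> powr \<alpha>) * exp (- \<epsilon> * (norm \<xi>)\<^sup>2)\<bar> \<partial>(lborel :: (real^'n) measure)) \<le>
      (\<integral>\<xi>. exp (- t * norm \<xi> powr \<alpha>) \<partial>(lborel :: (real^'n) measure))"
    by (rule integral_mono[OF integrable_abs[OF int] integrable_stretched_exp[OF assms(1,2)]])
      (use assms in auto)
  then show ?thesis
    using fourier_kernel_bounded[OF int, of x] unfolding mixture_kernel_def norm_square_powr
    by (auto elim!: order_trans intro: divide_right_mono)
qed

proposition mid_cone_stable_step:
  fixes a :: "real^'n::finite"
  assumes \<alpha>: "0 < \<alpha>" "\<alpha> \<le> 2" and t: "0 < t" and a: "\<And>i. 0 < a $ i" and F: "mid_cone a F"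
  shows "mid_cone a (killed_step (box (- a) a) (stable_kernel \<alpha> t) F)"
proof -
  obtain M where M: "\<And>x. x \<in> box (- a) a \<Longrightarrow> \<bar>F x\<bar> \<le> M" using mid_cone_bounded[OF F] by blast
  let ?K = "\<lambda>k. mixture_kernel (\<lambda>l. exp (- t * l powr (\<alpha> / 2))) (1 / real (Suc k)) :: real^'n \<Rightarrow> real"
  have bd: "\<bar>?K k x\<bar> \<le> (\<integral>\<xi>. exp (- t * norm \<xi> powr \<alpha>) \<partial>(lborel :: (real^'n) measure)) / (2 * pi) ^ CARD('n)" for k x
    by (rule mixture_kernel_le_stable) (use \<alpha> t in auto)
  note [measurable] = mid_cone_measurable[OF F]
  have 1: "mid_cone a (killed_step (box (- a) a) (?K k) F)" for k
    by (intro mid_cone_mixture_step laplace_mixture_exp_powr a F) (use \<alpha> t in auto)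
  have 2: "(\<lambda>k. killed_step (box (- a) a) (?K k) F x) \<longlonglongrightarrow> killed_step (box (- a) a) (stable_kernel \<alpha> t) F x" for x
    by (rule killed_step_tendsto[OF _ _ _ _ bd M mixture_kernel_tendsto_stable_kernel[OF \<alpha>(1) t] tendsto_const]) auto
  have 3: "\<bar>killed_step (box (- a) a) (?K k) F x\<bar> \<le> (\<integral>\<xi>. exp (- t * norm \<xi> powr \<alpha>) \<partial>(lborel :: (real^'n) measure)) / (2 * pi) ^ CARD('n)
      * M * measure lborel (box (- a) a)" for k x
    by (rule killed_step_bounded[OF _ _ _ _ bd M]) auto
  show ?thesis by (rule mid_cone.limit[OF 1 3 2])
qed

section \<open>Uniqueness of the stable density\<close>

lemma integrable_lborel_pair_mult:
  fixes f :: "'a::euclidean_space \<Rightarrow> real" and g :: "'b::euclidean_space \<Rightarrow> real"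
  assumes f: "integrable lborel f" and g: "integrable lborel g"
  shows "integrable (lborel \<Otimes>\<^sub>M lborel) (\<lambda>(x, y). f x * g y)"
proof (rule lborel_pair.Fubini_integrable)
  have [measurable]: "f \<in> borel_measurable borel" "g \<in> borel_measurable borel"
    using f g by (auto dest: borel_measurable_integrable)
  show "(\<lambda>(x, y). f x * g y) \<in> borel_measurable (lborel \<Otimes>\<^sub>M lborel)" by measurable
  show "integrable lborel (\<lambda>x. \<integral>y. norm (case (x, y) of (x, y) \<Rightarrow> f x * g y) \<partial>lborel)"
    using f by (simp add: abs_mult)
  show "AE x in lborel. integrable lborel (\<lambda>y. case (x, y) of (x, y) \<Rightarrow> f x * g y)"
    using g by simp
qed

lemma gaussian_nonneg: "0 \<le> gaussian \<sigma> x"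
  unfolding gaussian_def by (intro prod_nonneg) simp

text \<open>Convolution with a Gaussian turns the Fourier inversion formula into an instance of Fubini's theorem, as the Gaussian is itself
a Fourier integral.\<close>

lemma fourier_smoothing:
  fixes p :: "real^'n::finite \<Rightarrow> real" and \<psi> :: "real^'n \<Rightarrow> real"
  assumes p: "integrable lborel p" and \<epsilon>: "0 < \<epsilon>"
    and FT: "\<And>\<xi>. (\<integral>y. iexp (\<xi> \<bullet> y) * complex_of_real (p y) \<partial>lborel) = complex_of_real (\<psi> \<xi>)"
  shows "(\<integral>y. gaussian (sqrt (2 * \<epsilon>)) (x - y) * p y \<partial>lborel) =
    fourier_kernel (\<lambda>\<xi>. \<psi> (- \<xi>) * exp (- \<epsilon> * (norm \<xi>)\<^sup>2)) x"
proof -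
  have [measurable]: "p \<in> borel_measurable borel" using p by (auto dest: borel_measurable_integrable)
  define c where "c = (2 * pi) ^ CARD('n)"
  have c: "0 < c" unfolding c_def by simp
  define e where "e \<xi> = exp (- \<epsilon> * (norm \<xi>)\<^sup>2)" for \<xi> :: "real^'n"
  have [measurable]: "e \<in> borel_measurable borel" unfolding e_def by measurable
  have e_int: "integrable lborel e" unfolding e_def by (rule integrable_exp_norm_square[OF \<epsilon>])
  let ?h = "\<lambda>y \<xi>. iexp (\<xi> \<bullet> (x - y)) * complex_of_real (e \<xi>) * complex_of_real (p y)"
  have int: "integrable (lborel \<Otimes>\<^sub>M lborel) (\<lambda>(y, \<xi>). ?h y \<xi>)"
    by (rule Bochner_Integration.integrable_bound[OF integrable_lborel_pair_mult[OF p e_int]])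
      (auto simp: norm_mult abs_mult split_beta e_def)
  have split: "?h y \<xi> = (iexp (\<xi> \<bullet> x) * complex_of_real (e \<xi>)) * (iexp ((- \<xi>) \<bullet> y) * complex_of_real (p y))" for y \<xi>
  proof -
    have "iexp (\<xi> \<bullet> (x - y)) = iexp (\<xi> \<bullet> x) * iexp ((- \<xi>) \<bullet> y)"
      by (simp add: exp_add[symmetric] inner_diff_right algebra_simps)
    then show ?thesis by simp
  qed
  have "complex_of_real (c * (\<integral>y. gaussian (sqrt (2 * \<epsilon>)) (x - y) * p y \<partial>lborel)) =
      (\<integral>y. complex_of_real (c * gaussian (sqrt (2 * \<epsilon>)) (x - y)) * complex_of_real (p y) \<partial>lborel)"
    by (simp add: mult.assoc flip: of_real_mult)
  also have "\<dots> = (\<integral>y. (\<integral>\<xi>. ?h y \<xi> \<partial>lborel) \<partial>lborel)"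
    unfolding c_def e_def fourier_exp_norm_square(2)[OF \<epsilon>, symmetric] by simp
  also have "\<dots> = (\<integral>\<xi>. (\<integral>y. ?h y \<xi> \<partial>lborel) \<partial>lborel)"
    by (rule lborel_pair.Fubini_integral[OF int, symmetric])
  also have "\<dots> = (\<integral>\<xi>. iexp (\<xi> \<bullet> x) * complex_of_real (e \<xi>) * complex_of_real (\<psi> (- \<xi>)) \<partial>lborel)"
    by (simp only: split integral_mult_right_zero FT)
  finally have eq: "complex_of_real (c * (\<integral>y. gaussian (sqrt (2 * \<epsilon>)) (x - y) * p y \<partial>lborel)) = \<dots>" .
  have int': "integrable lborel (\<lambda>\<xi>. iexp (\<xi> \<bullet> x) * complex_of_real (e \<xi>) * complex_of_real (\<psi> (- \<xi>)))"
    using lborel_pair.integrable_snd[OF int] by (simp only: split integral_mult_right_zero FT prod.case)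
  have "c * (\<integral>y. gaussian (sqrt (2 * \<epsilon>)) (x - y) * p y \<partial>lborel) =
      (\<integral>\<xi>. Re (iexp (\<xi> \<bullet> x) * complex_of_real (e \<xi>) * complex_of_real (\<psi> (- \<xi>))) \<partial>lborel)"
    unfolding integral_Re[OF int'] eq[symmetric] by simp
  also have "\<dots> = (\<integral>\<xi>. cos (\<xi> \<bullet> x) * (\<psi> (- \<xi>) * e \<xi>) \<partial>lborel)"
    by (simp add: cis_conv_exp[symmetric] mult_ac)
  finally show ?thesis
    using c unfolding fourier_kernel_def e_def c_def[symmetric] by (simp add: field_simps)
qed

lemma normal_mass_interval_tendsto:
  assumes y: "y \<noteq> l" "y \<noteq> u" and \<sigma>: "\<sigma> \<longlonglongrightarrow> 0" "\<And>k. 0 < \<sigma> k"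
  shows "(\<lambda>k. \<integral>x. indicator {l<..<u} x * normal_density 0 (\<sigma> k) (x - y) \<partial>lborel) \<longlonglongrightarrow> indicator {l<..<u} y"
proof -
  have "(\<integral>x. indicator {l<..<u} x * normal_density 0 (\<sigma> k) (x - y) \<partial>lborel) =
      (\<integral>v. indicator {l<..<u} (y + \<sigma> k * v) * std_normal_density v \<partial>lborel)" for k
  proof -
    have nd: "normal_density 0 (\<sigma> k) (\<sigma> k * v) * \<sigma> k = std_normal_density v" for v
      using \<sigma>(2)[of k] unfolding normal_density_def
      by (simp add: power_mult_distrib real_sqrt_mult field_simps)
    have "(\<integral>x. indicator {l<..<u} x * normal_density 0 (\<sigma> k) (x - y) \<partial>lborel) =
        \<sigma> k * (\<integral>v. indicator {l<..<u} (y + \<sigma> k * v) * normal_density 0 (\<sigma> k) (\<sigma> k * v) \<partial>lborel)"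
      using \<sigma>(2)[of k]
      by (subst lborel_integral_real_affine[where c = "\<sigma> k" and t = y]) auto
    also have "\<dots> = (\<integral>v. indicator {l<..<u} (y + \<sigma> k * v) * (normal_density 0 (\<sigma> k) (\<sigma> k * v) * \<sigma> k) \<partial>lborel)"
      by (subst integral_mult_right_zero[symmetric]) (simp add: mult_ac)
    finally show ?thesis unfolding nd .
  qed
  moreover have "(\<lambda>k. \<integral>v. indicator {l<..<u} (y + \<sigma> k * v) * std_normal_density v \<partial>lborel) \<longlonglongrightarrow>
      (\<integral>v. indicator {l<..<u} y * std_normal_density v \<partial>lborel)"
  proof (rule integral_dominated_convergence[where w = std_normal_density])
    have "frontier {l<..<u} \<subseteq> {l, u}"
      by (cases "l < u") (auto simp: frontier_def)
    then have cont: "isCont (indicator {l<..<u} :: real \<Rightarrow> real) y"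
      using y unfolding isCont_indicator by auto
    have "(\<lambda>k. y + \<sigma> k * v) \<longlonglongrightarrow> y + 0 * v" for v
      by (intro tendsto_intros \<sigma>)
    then have "(\<lambda>k. indicator {l<..<u} (y + \<sigma> k * v) :: real) \<longlonglongrightarrow> indicator {l<..<u} y" for v
      using isCont_tendsto_compose[OF cont, of "\<lambda>k. y + \<sigma> k * v"] by simp
    then show "AE v in lborel. (\<lambda>k. indicator {l<..<u} (y + \<sigma> k * v) * std_normal_density v) \<longlonglongrightarrow>
        indicator {l<..<u} y * std_normal_density v"
      by (intro AE_I2 tendsto_intros)
  qed (auto simp: integrable_normal_density indicator_def)
  ultimately show ?thesis by (simp add: integral_normal_density)
qed

lemma gaussian_mass_box:
  fixes l u y :: "real^'n::finite"
  assumes \<sigma>: "0 < \<sigma>"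
  shows "integrable lborel (\<lambda>x. indicator (box l u) x * gaussian \<sigma> (x - y))"
    and "(\<integral>x. indicator (box l u) x * gaussian \<sigma> (x - y) \<partial>lborel) =
      (\<Prod>i\<in>UNIV. \<integral>x. indicator {l $ i<..<u $ i} x * normal_density 0 \<sigma> (x - y $ i) \<partial>lborel)"
    and "\<bar>\<integral>x. indicator (box l u) x * gaussian \<sigma> (x - y) \<partial>lborel\<bar> \<le> 1"
proof -
  have ind: "indicator (box l u) x = (\<Prod>i\<in>UNIV. indicator {l $ i<..<u $ i} (x $ i) :: real)" for x
    by (auto simp: indicator_def mem_box_cart prod_zero_iff)
  have eq: "indicator (box l u) x * gaussian \<sigma> (x - y) =
      (\<Prod>i\<in>UNIV. indicator {l $ i<..<u $ i} (x $ i) * normal_density 0 \<sigma> (x $ i - y $ i))" for x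
    unfolding ind gaussian_def prod.distrib by simp
  have nd: "integrable lborel (\<lambda>x. normal_density 0 \<sigma> (x - c))" "(\<integral>x. normal_density 0 \<sigma> (x - c) \<partial>lborel) = 1" for c
  proof -
    have "normal_density 0 \<sigma> (x - c) = normal_density c \<sigma> x" for x by (simp add: normal_density_def)
    then show "integrable lborel (\<lambda>x. normal_density 0 \<sigma> (x - c))" "(\<integral>x. normal_density 0 \<sigma> (x - c) \<partial>lborel) = 1"
      using integrable_normal_density[OF \<sigma>, of c] integral_normal_density[OF \<sigma>, of c] by simp_all
  qed
  have int: "integrable lborel (\<lambda>x. indicator {l $ i<..<u $ i} x * normal_density 0 \<sigma> (x - y $ i))" for i
    by (rule Bochner_Integration.integrable_bound[OF nd(1)[of "y $ i"]]) (auto simp: indicator_def)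
  show "integrable lborel (\<lambda>x. indicator (box l u) x * gaussian \<sigma> (x - y))"
    unfolding eq by (rule integral_prod_cart(1)[OF int])
  show prod: "(\<integral>x. indicator (box l u) x * gaussian \<sigma> (x - y) \<partial>lborel) =
      (\<Prod>i\<in>UNIV. \<integral>x. indicator {l $ i<..<u $ i} x * normal_density 0 \<sigma> (x - y $ i) \<partial>lborel)"
    unfolding eq by (rule integral_prod_cart(2)[OF int])
  have "(\<integral>x. indicator {l $ i<..<u $ i} x * normal_density 0 \<sigma> (x - y $ i) \<partial>lborel) \<le> 1" for i
    unfolding nd(2)[of "y $ i", symmetric] by (intro integral_mono int nd(1)) (auto simp: indicator_def)
  moreover have "0 \<le> (\<integral>x. indicator {l $ i<..<u $ i} x * normal_density 0 \<sigma> (x - y $ i) \<partial>lborel)" for i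
    by (intro Bochner_Integration.integral_nonneg) auto
  ultimately show "\<bar>\<integral>x. indicator (box l u) x * gaussian \<sigma> (x - y) \<partial>lborel\<bar> \<le> 1"
    unfolding prod abs_prod by (intro prod_le_1) auto
qed

lemma AE_lborel_component_neq: "AE y in lborel. \<forall>i. (y::real^'n::finite) $ i \<noteq> c $ i"
proof -
  have "AE y in lborel. (y::real^'n) $ i \<noteq> c $ i" for i
  proof (rule AE_I')
    have "{y::real^'n. y $ i = c $ i} \<in> null_sets lebesgue"
      using negligible_standard_hyperplane[of "axis i 1 :: real^'n" "c $ i"]
      by (simp add: negligible_iff_null_sets inner_axis)
    moreover have "{y::real^'n. y $ i = c $ i} \<in> sets lborel" by simp
    ultimately show "{y::real^'n. y $ i = c $ i} \<in> null_sets lborel"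
      using null_sets_completion_iff by blast
  qed auto
  then show ?thesis by (simp add: AE_all_countable)
qed

text \<open>By Fubini's theorem the Gaussian may be integrated over the box first. The resulting mass tends to the indicator of the box at
every point whose coordinates avoid those of the faces, hence almost everywhere.\<close>

lemma integral_gaussian_smoothing_tendsto:
  fixes p :: "real^'n::finite \<Rightarrow> real"
  assumes p: "integrable lborel p" and \<sigma>: "\<sigma> \<longlonglongrightarrow> 0" "\<And>k. 0 < \<sigma> k"
  shows "(\<lambda>k. \<integral>x. indicator (box l u) x * (\<integral>y. gaussian (\<sigma> k) (x - y) * p y \<partial>lborel) \<partial>lborel) \<longlonglongrightarrow>
    (\<integral>y. indicator (box l u) y * p y \<partial>lborel)"
proof -
  have [measurable]: "p \<in> borel_measurable borel" using p by (auto dest: borel_measurable_integrable)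
  let ?J = "\<lambda>k y. \<integral>x. indicator (box l u) x * gaussian (\<sigma> k) (x - y) \<partial>lborel"
  have "(\<integral>x. indicator (box l u) x * (\<integral>y. gaussian (\<sigma> k) (x - y) * p y \<partial>lborel) \<partial>lborel) = (\<integral>y. ?J k y * p y \<partial>lborel)" for k
  proof -
    let ?C = "\<Prod>i\<in>(UNIV::'n set). normal_density 0 (\<sigma> k) 0"
    have box: "integrable lborel (\<lambda>x::real^'n. indicator (box l u) x * ?C)"
      using emeasure_lborel_box_finite[of l u] by (intro integrable_mult_left integrable_real_indicator) auto
    have int: "integrable (lborel \<Otimes>\<^sub>M lborel) (\<lambda>(x, y). indicator (box l u) x * (gaussian (\<sigma> k) (x - y) * p y))"
    proof (rule Bochner_Integration.integrable_bound[OF integrable_lborel_pair_mult[OF box p]])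
      show "AE z in lborel \<Otimes>\<^sub>M lborel. norm (case z of (x, y) \<Rightarrow> indicator (box l u) x * (gaussian (\<sigma> k) (x - y) * p y)) \<le>
          norm (case z of (x, y) \<Rightarrow> indicator (box l u) x * ?C * p y)"
      proof -
        have "norm (indicator (box l u) x * (gaussian (\<sigma> k) (x - y) * p y)) \<le> norm (indicator (box l u) x * ?C * p y)"
          for x y :: "real^'n"
        proof -
          have "\<bar>gaussian (\<sigma> k) (x - y)\<bar> \<le> \<bar>?C\<bar>"
            using gaussian_bounded[OF \<sigma>(2)[of k], of "x - y"] by linarith
          then show ?thesis
            unfolding real_norm_def abs_mult mult.assoc by (intro mult_left_mono mult_right_mono) auto
        qed
        then show ?thesis by (simp add: split_beta)
      qed
    qed measurable
    have "(\<integral>x. indicator (box l u) x * (\<integral>y. gaussian (\<sigma> k) (x - y) * p y \<partial>lborel) \<partial>lborel) =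
        (\<integral>x. (\<integral>y. indicator (box l u) x * (gaussian (\<sigma> k) (x - y) * p y) \<partial>lborel) \<partial>lborel)"
      by simp
    also have "\<dots> = (\<integral>y. (\<integral>x. indicator (box l u) x * (gaussian (\<sigma> k) (x - y) * p y) \<partial>lborel) \<partial>lborel)"
      by (rule lborel_pair.Fubini_integral[OF int, symmetric])
    also have "\<dots> = (\<integral>y. ?J k y * p y \<partial>lborel)" by (simp flip: mult.assoc)
    finally show ?thesis .
  qed
  moreover have "(\<lambda>k. \<integral>y. ?J k y * p y \<partial>lborel) \<longlonglongrightarrow> (\<integral>y. indicator (box l u) y * p y \<partial>lborel)"
  proof (rule integral_dominated_convergence[where w = "\<lambda>y. \<bar>p y\<bar>"])
    show "AE y in lborel. (\<lambda>k. ?J k y * p y) \<longlonglongrightarrow> indicator (box l u) y * p y"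
      using AE_lborel_component_neq[of l] AE_lborel_component_neq[of u]
    proof eventually_elim
      case (elim y)
      have "indicator (box l u) y = (\<Prod>i\<in>UNIV. indicator {l $ i<..<u $ i} (y $ i) :: real)"
        by (auto simp: indicator_def mem_box_cart prod_zero_iff)
      then show ?case
        unfolding gaussian_mass_box(2)[OF \<sigma>(2)] using elim
        by (auto intro!: tendsto_intros normal_mass_interval_tendsto \<sigma>)
    qed
    show "AE y in lborel. norm (?J k y * p y) \<le> \<bar>p y\<bar>" for k
      using gaussian_mass_box(3)[OF \<sigma>(2)[of k], of l u]
      by (auto simp: abs_mult intro!: mult_left_le_one_le)
  qed (use p in auto)
  ultimately show ?thesis by simp
qed

text \<open>The convolution of \<open>p\<close> with a small Gaussian is a \<open>mixture_kernel\<close>. As the Gaussian shrinks, this converges boundedly to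
\<open>stable_kernel\<close>, whereas its integral over a box converges to that of \<open>p\<close>. So the two densities have equal integrals over boxes,
which generate the Borel sets. Nonnegativity of \<open>stable_kernel\<close> is a by-product of the pointwise limit.\<close>

proposition stable_density_unique:
  fixes p :: "real^'n::finite \<Rightarrow> real"
  assumes \<alpha>: "0 < \<alpha>" and t: "0 < t" and p: "integrable lborel p" "\<And>y. 0 \<le> p y"
    and FT: "\<And>\<xi>. (\<integral>y. iexp (\<xi> \<bullet> y) * complex_of_real (p y) \<partial>lborel) =
      complex_of_real (exp (- t * norm \<xi> powr \<alpha>))"
  shows "0 \<le> stable_kernel \<alpha> t (x :: real^'n)"
    and "density lborel (\<lambda>y. ennreal (p y)) = density lborel (\<lambda>y. ennreal (stable_kernel \<alpha> t y))"
proof -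
  have [measurable]: "p \<in> borel_measurable borel" using p by (auto dest: borel_measurable_integrable)
  define \<epsilon> where "\<epsilon> k = 1 / real (Suc k)" for k
  have \<epsilon>: "0 < \<epsilon> k" for k unfolding \<epsilon>_def by simp
  let ?K = "\<lambda>k. mixture_kernel (\<lambda>l. exp (- t * l powr (\<alpha> / 2))) (\<epsilon> k) :: real^'n \<Rightarrow> real"
  let ?C = "(\<integral>\<xi>. exp (- t * norm \<xi> powr \<alpha>) \<partial>(lborel :: (real^'n) measure)) / (2 * pi) ^ CARD('n)"
  have K: "?K k x = (\<integral>y. gaussian (sqrt (2 * \<epsilon> k)) (x - y) * p y \<partial>lborel)" for k x
    unfolding mixture_kernel_def norm_square_powr by (simp add: fourier_smoothing[OF p(1) \<epsilon> FT])
  have K_lim: "(\<lambda>k. ?K k x) \<longlonglongrightarrow> stable_kernel \<alpha> t x" for x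
    unfolding \<epsilon>_def by (rule mixture_kernel_tendsto_stable_kernel[OF \<alpha> t])
  have K_bd: "\<bar>?K k x\<bar> \<le> ?C" for k x
    by (rule mixture_kernel_le_stable[OF \<alpha> t \<epsilon>])
  show nonneg: "0 \<le> stable_kernel \<alpha> t x" for x :: "real^'n"
  proof (rule LIMSEQ_le_const[OF K_lim], intro exI[of _ 0] allI impI)
    show "0 \<le> ?K k x" for k
      unfolding K by (intro Bochner_Integration.integral_nonneg mult_nonneg_nonneg gaussian_nonneg p)
  qed
  have box_int: "integrable lborel (\<lambda>x::real^'n. indicator (box l u) x * c :: real)" for l u c
    using emeasure_lborel_box_finite[of l u] by (intro integrable_mult_left integrable_real_indicator) auto
  have box_eq: "(\<integral>x. indicator (box l u) x * stable_kernel \<alpha> t x \<partial>lborel) = (\<integral>x. indicator (box l u) x * p x \<partial>lborel)" for l u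
  proof (rule LIMSEQ_unique)
    show "(\<lambda>k. \<integral>x. indicator (box l u) x * ?K k x \<partial>lborel) \<longlonglongrightarrow> (\<integral>x. indicator (box l u) x * stable_kernel \<alpha> t x \<partial>lborel)"
    proof (rule integral_dominated_convergence[OF _ _ box_int[of l u ?C]])
      show "AE x in lborel. (\<lambda>k. indicator (box l u) x * ?K k x) \<longlonglongrightarrow> indicator (box l u) x * stable_kernel \<alpha> t x"
        by (intro AE_I2 tendsto_intros K_lim)
      show "AE x in lborel. norm (indicator (box l u) x * ?K k x) \<le> indicator (box l u) x * ?C" for k
        using K_bd[of k] by (auto simp: indicator_def)
    qed auto
    have "(\<lambda>k. sqrt (2 * \<epsilon> k)) \<longlonglongrightarrow> sqrt (2 * 0)"
      unfolding \<epsilon>_def by (intro tendsto_intros LIMSEQ_Suc[OF lim_1_over_n])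
    then show "(\<lambda>k. \<integral>x. indicator (box l u) x * ?K k x \<partial>lborel) \<longlonglongrightarrow> (\<integral>x. indicator (box l u) x * p x \<partial>lborel)"
      unfolding K using \<epsilon> by (intro integral_gaussian_smoothing_tendsto p) auto
  qed
  have q_bd: "\<bar>stable_kernel \<alpha> t x\<bar> \<le> ?C" for x :: "real^'n"
    using LIMSEQ_le_const2[OF tendsto_rabs[OF K_lim]] K_bd by blast
  have emeasure_p: "emeasure (density lborel (\<lambda>y. ennreal (p y))) (box l u) = ennreal (\<integral>x. indicator (box l u) x * p x \<partial>lborel)" for l u
  proof -
    have "integrable lborel (\<lambda>x. indicator (box l u) x * p x)"
      by (rule Bochner_Integration.integrable_bound[OF p(1)]) (auto simp: indicator_def)
    then show ?thesis
      using p(2) by (subst emeasure_density) (auto simp: nn_integral_eq_integral[symmetric] indicator_def intro!: nn_integral_cong)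
  qed
  have emeasure_q: "emeasure (density lborel (\<lambda>y. ennreal (stable_kernel \<alpha> t y))) (box l u) =
      ennreal (\<integral>x. indicator (box l u) x * stable_kernel \<alpha> t x \<partial>lborel)" for l u :: "real^'n"
  proof -
    have "integrable lborel (\<lambda>x::real^'n. indicator (box l u) x * stable_kernel \<alpha> t x)"
      by (rule Bochner_Integration.integrable_bound[OF box_int[of l u ?C]]) (use q_bd in \<open>auto simp: indicator_def intro: order_trans\<close>)
    then show ?thesis
      using nonneg by (subst emeasure_density) (auto simp: nn_integral_eq_integral[symmetric] indicator_def intro!: nn_integral_cong)
  qed
  show "density lborel (\<lambda>y. ennreal (p y)) = density lborel (\<lambda>y. ennreal (stable_kernel \<alpha> t y))"
  proof (rule measure_eqI_generator_eq)
    let ?E = "range (\<lambda>(a, b). box a b :: (real^'n) set)"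
    show "Int_stable ?E" by (auto simp: Int_stable_def box_Int_box)
    show "?E \<subseteq> Pow UNIV" "sets (density lborel (\<lambda>y. ennreal (p y))) = sigma_sets UNIV ?E"
      "sets (density lborel (\<lambda>y::real^'n. ennreal (stable_kernel \<alpha> t y))) = sigma_sets UNIV ?E"
      by (simp_all add: borel_eq_box)
    let ?A = "\<lambda>n::nat. box (- (real n *\<^sub>R One)) (real n *\<^sub>R One) :: (real^'n) set"
    show "range ?A \<subseteq> ?E" "(\<Union>i. ?A i) = UNIV" unfolding UN_box_eq_UNIV by auto
    show "emeasure (density lborel (\<lambda>y. ennreal (p y))) (?A i) \<noteq> \<infinity>" for i
      by (simp add: emeasure_p)
    show "emeasure (density lborel (\<lambda>y. ennreal (p y))) B = emeasure (density lborel (\<lambda>y. ennreal (stable_kernel \<alpha> t y))) B"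
      if "B \<in> ?E" for B
      using that by (auto simp: emeasure_p emeasure_q box_eq)
  qed
qed

section \<open>Survival probabilities\<close>

text \<open>The probability that a walk started at \<open>x\<close>, whose successive transition densities are \<open>K m, K (m + 1), \<dots>\<close>, stays in \<open>Q\<close> for
\<open>j\<close> steps. The index \<open>m\<close> of the first step is a parameter because the recursion splits off that step.\<close>

fun survival :: "'a::euclidean_space set \<Rightarrow> (nat \<Rightarrow> 'a \<Rightarrow> real) \<Rightarrow> nat \<Rightarrow> nat \<Rightarrow> 'a \<Rightarrow> real" where
  "survival Q K m 0 x = 1"
| "survival Q K m (Suc j) x = killed_step Q (K m) (survival Q K (Suc m) j) x"

lemma killed_step_measurable [measurable]:
  fixes K F :: "'a::euclidean_space \<Rightarrow> real"
  assumes [measurable]: "K \<in> borel_measurable borel" "F \<in> borel_measurable borel" "Q \<in> sets borel"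
  shows "killed_step Q K F \<in> borel_measurable borel"
  unfolding killed_step_def[abs_def] by measurable

lemma nn_integral_lborel_shift:
  fixes x :: "'a::euclidean_space"
  assumes [measurable]: "f \<in> borel_measurable borel"
  shows "(\<integral>\<^sup>+ y. f (x + y) \<partial>lborel) = (\<integral>\<^sup>+ y. f y \<partial>lborel)"
proof -
  have "(\<integral>\<^sup>+ y. f y \<partial>lborel) = (\<integral>\<^sup>+ y. f y \<partial>distr lborel borel ((+) x))"
    by (simp add: lborel_distr_plus)
  also have "\<dots> = (\<integral>\<^sup>+ y. f (x + y) \<partial>lborel)" by (subst nn_integral_distr) auto
  finally show ?thesis ..
qed

text \<open>Integrating out the first step by Fubini's theorem gives the recursion of \<open>survival\<close>. Measurability and the bounds are
carried along in the induction since they are needed for the integrals of the next step.\<close>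

lemma survival_eq_emeasure:
  fixes K :: "nat \<Rightarrow> 'a::euclidean_space \<Rightarrow> real"
  assumes K[measurable]: "\<And>k. K k \<in> borel_measurable borel" and K_nonneg: "\<And>k z. 0 \<le> K k z"
    and K_even: "\<And>k z. K k (- z) = K k z" and K_bd: "\<And>k z. K k z \<le> C k"
    and prob: "\<And>k. prob_space (density lborel (\<lambda>z. ennreal (K k z)))"
    and Q[measurable]: "Q \<in> sets borel" and bQ: "bounded Q"
  shows "survival Q K m j \<in> borel_measurable borel \<and> (\<forall>x. 0 \<le> survival Q K m j x \<and> survival Q K m j x \<le> 1 \<and>
    emeasure (\<Pi>\<^sub>M k\<in>{m..<m+j}. density lborel (\<lambda>z. ennreal (K k z)))
      {z\<in>space (\<Pi>\<^sub>M k\<in>{m..<m+j}. borel). \<forall>k\<in>{m..<m+j}. x + (\<Sum>i\<in>{m..k}. z i) \<in> Q} =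
    ennreal (survival Q K m j x))"
proof (induction j arbitrary: m)
  case 0
  have "survival Q K m 0 = (\<lambda>_. 1)" by auto
  then show ?case by (simp add: space_PiM PiM_empty)
next
  case (Suc j)
  let ?N = "\<lambda>k. density lborel (\<lambda>z. ennreal (K k z))"
  let ?I = "{Suc m..<Suc m + j}"
  interpret product_prob_space ?N "UNIV :: nat set"
    using prob by (simp add: product_prob_space_def product_prob_space_axioms_def product_sigma_finite_def prob_space_imp_sigma_finite)
  let ?S = "survival Q K (Suc m) j"
  have S[measurable]: "?S \<in> borel_measurable borel" and S_nonneg: "\<And>x. 0 \<le> ?S x" and S_le: "\<And>x. ?S x \<le> 1"
    and S_eq: "\<And>x. emeasure (\<Pi>\<^sub>M k\<in>?I. ?N k)
      {z\<in>space (\<Pi>\<^sub>M k\<in>?I. borel). \<forall>k\<in>?I. x + (\<Sum>i\<in>{Suc m..k}. z i) \<in> Q} = ennreal (?S x)"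
    using Suc.IH[of "Suc m"] by auto
  have eq: "survival Q K m (Suc j) = killed_step Q (K m) ?S" by (auto simp: fun_eq_iff)
  have I: "{m..<m + Suc j} = insert m ?I" by auto
  have meas: "survival Q K m (Suc j) \<in> borel_measurable borel" unfolding eq by measurable
  have nonneg: "0 \<le> survival Q K m (Suc j) x" for x
    unfolding eq killed_step_def using K_nonneg S_nonneg by (intro Bochner_Integration.integral_nonneg) auto
  have em: "emeasure (\<Pi>\<^sub>M k\<in>{m..<m + Suc j}. ?N k)
      {z\<in>space (\<Pi>\<^sub>M k\<in>{m..<m + Suc j}. borel). \<forall>k\<in>{m..<m + Suc j}. x + (\<Sum>i\<in>{m..k}. z i) \<in> Q} =
    ennreal (survival Q K m (Suc j) x)" for x
  proof -
    let ?A = "{z\<in>space (\<Pi>\<^sub>M k\<in>insert m ?I. borel). \<forall>k\<in>insert m ?I. x + (\<Sum>i\<in>{m..k}. z i) \<in> Q}"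
    let ?A' = "\<lambda>x. {z\<in>space (\<Pi>\<^sub>M k\<in>?I. borel). \<forall>k\<in>?I. x + (\<Sum>i\<in>{Suc m..k}. z i) \<in> Q}"
    have sets_eq: "sets (\<Pi>\<^sub>M k\<in>J. ?N k) = sets (\<Pi>\<^sub>M k\<in>J. (borel :: 'a measure))" for J
      by (intro sets_PiM_cong) auto
    have A[measurable]: "?A \<in> sets (\<Pi>\<^sub>M k\<in>insert m ?I. ?N k)"
      unfolding sets_eq by measurable auto
    have A'[measurable]: "?A' x \<in> sets (\<Pi>\<^sub>M k\<in>?I. ?N k)" for x
      unfolding sets_eq by measurable
    have upd: "indicator ?A (z(m := y)) = (indicator Q (x + y) * indicator (?A' (x + y)) z :: ennreal)"
      if z: "z \<in> space (\<Pi>\<^sub>M k\<in>?I. ?N k)" for z y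
    proof -
      have sum: "(\<Sum>i\<in>{m..k}. (z(m := y)) i) = y + (\<Sum>i\<in>{Suc m..k}. z i)" if "m \<le> k" for k
        using that by (subst sum.atLeast_Suc_atMost) (auto intro!: sum.cong)
      have "z(m := y) \<in> ?A \<longleftrightarrow> x + y \<in> Q \<and> z \<in> ?A' (x + y)"
        using z by (auto simp: space_PiM PiE_iff extensional_def sum[unfolded fun_upd_apply] add.assoc)
      then show ?thesis by (auto simp: indicator_def)
    qed
    have "emeasure (\<Pi>\<^sub>M k\<in>insert m ?I. ?N k) ?A = (\<integral>\<^sup>+ z. indicator ?A z \<partial>(\<Pi>\<^sub>M k\<in>insert m ?I. ?N k))"
      by (rule nn_integral_indicator[OF A, symmetric])
    also have "\<dots> = (\<integral>\<^sup>+ y. (\<integral>\<^sup>+ z. indicator ?A (z(m := y)) \<partial>(\<Pi>\<^sub>M k\<in>?I. ?N k)) \<partial>?N m)"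
      by (rule product_nn_integral_insert_rev[OF _ _ borel_measurable_indicator[OF A]]) auto
    also have "\<dots> = (\<integral>\<^sup>+ y. indicator Q (x + y) * ennreal (?S (x + y)) \<partial>?N m)"
    proof (intro nn_integral_cong)
      fix y
      have "(\<integral>\<^sup>+ z. indicator ?A (z(m := y)) \<partial>(\<Pi>\<^sub>M k\<in>?I. ?N k)) =
          (\<integral>\<^sup>+ z. indicator Q (x + y) * indicator (?A' (x + y)) z \<partial>(\<Pi>\<^sub>M k\<in>?I. ?N k))"
        by (intro nn_integral_cong upd)
      also have "\<dots> = indicator Q (x + y) * ennreal (?S (x + y))"
        by (simp only: nn_integral_cmult_indicator[OF A'] S_eq)
      finally show "(\<integral>\<^sup>+ z. indicator ?A (z(m := y)) \<partial>(\<Pi>\<^sub>M k\<in>?I. ?N k)) = indicator Q (x + y) * ennreal (?S (x + y))" .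
    qed
    also have "\<dots> = (\<integral>\<^sup>+ y. ennreal (K m (x - (x + y))) * (indicator Q (x + y) * ennreal (?S (x + y))) \<partial>lborel)"
      by (subst nn_integral_density) (auto simp: K_even)
    also have "\<dots> = (\<integral>\<^sup>+ y. ennreal (K m (x - y)) * (indicator Q y * ennreal (?S y)) \<partial>lborel)"
      by (rule nn_integral_lborel_shift) measurable
    also have "\<dots> = (\<integral>\<^sup>+ y. ennreal (indicator Q y * (K m (x - y) * ?S y)) \<partial>lborel)"
      by (intro nn_integral_cong) (auto simp: indicator_def ennreal_mult K_nonneg S_nonneg)
    also have "\<dots> = ennreal (killed_step Q (K m) ?S x)"
      unfolding killed_step_def
    proof (rule nn_integral_eq_integral)
      show "integrable lborel (\<lambda>y. indicator Q y * (K m (x - y) * ?S y))"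
        using K_nonneg K_bd S_nonneg S_le bQ
        by (intro integrable_killed_step[where C = "C m" and B = 1]) auto
    qed (use K_nonneg S_nonneg in auto)
    finally show ?thesis unfolding I eq .
  qed
  have "prob_space (\<Pi>\<^sub>M k\<in>{m..<m + Suc j}. ?N k)" by (intro prob_space_PiM prob)
  then have "ennreal (survival Q K m (Suc j) x) \<le> 1" for x
    unfolding em[symmetric] by (rule prob_space.emeasure_le_1)
  then have "survival Q K m (Suc j) x \<le> 1" for x by simp
  then show ?case using meas nonneg em by blast
qed

lemma lborel_distr_reflect: "distr lborel borel uminus = (lborel :: 'a::euclidean_space measure)"
  by (subst (2) lborel_affine[of "-1" 0]) (auto simp: density_1 one_ennreal_def[symmetric])

text \<open>The increment has the law of \<open>X h - x\<close> under \<open>P x\<close>, whose density is \<open>p h\<close> reflected at 0. The reflected density has the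
same Fourier transform, so that it need not be shown that \<open>p h\<close> itself is even.\<close>

lemma stable_process_increment:
  fixes X :: "real \<Rightarrow> 'w \<Rightarrow> real^'n::finite"
  assumes \<alpha>: "0 < \<alpha>" and X: "symmetric_stable_process \<alpha> P X" and s: "0 \<le> s" and h: "0 < h"
  shows "distr (P x) borel (\<lambda>\<omega>. X (s + h) \<omega> - X s \<omega>) = density lborel (\<lambda>z. ennreal (stable_kernel \<alpha> h z))"
    and "0 \<le> stable_kernel \<alpha> h (z :: real^'n)"
proof -
  obtain p where p: "stable_density \<alpha> p"
    and dist: "\<And>x t. 0 < t \<Longrightarrow> distributed (P x) lborel (X t) (\<lambda>y. ennreal (p t (x - y)))"
    using X unfolding symmetric_stable_process_def by blast
  have levy: "levy_process (P x) X" and X0: "AE \<omega> in P x. X 0 \<omega> = x" for x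
    using X unfolding symmetric_stable_process_def by blast+
  interpret prob_space "P x" using levy unfolding levy_process_def by blast
  have Xm[measurable]: "X t \<in> borel_measurable (P x)" if "0 \<le> t" for t
    using levy that unfolding levy_process_def by blast
  have nonneg: "0 \<le> p h y" and int: "integrable lborel (p h)"
    and FT: "(\<integral>y. iexp (\<xi> \<bullet> y) * complex_of_real (p h y) \<partial>lborel) = complex_of_real (exp (- h * norm \<xi> powr \<alpha>))" for y \<xi>
    using p h unfolding stable_density_def by blast+
  have [measurable]: "p h \<in> borel_measurable borel" using int by (auto dest: borel_measurable_integrable)
  have int': "integrable lborel (\<lambda>z. p h (- z))"
    using int by (subst (asm) lborel_distr_reflect[symmetric], subst (asm) integrable_distr_eq) auto
  have FT': "(\<integral>y. iexp (\<xi> \<bullet> y) * complex_of_real (p h (- y)) \<partial>lborel) = complex_of_real (exp (- h * norm \<xi> powr \<alpha>))" for \<xi>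
  proof -
    have "(\<integral>y. iexp ((- \<xi>) \<bullet> y) * complex_of_real (p h y) \<partial>lborel) =
        (\<integral>y. iexp ((- \<xi>) \<bullet> (- y)) * complex_of_real (p h (- y)) \<partial>lborel)"
      by (subst lborel_distr_reflect[symmetric], subst integral_distr) auto
    then show ?thesis using FT[of "- \<xi>"] by simp
  qed
  note unique = stable_density_unique[OF \<alpha> h int' nonneg FT']
  show "0 \<le> stable_kernel \<alpha> h z" by (rule unique(1))
  have "distr (P x) borel (\<lambda>\<omega>. X (s + h) \<omega> - X s \<omega>) = distr (P x) borel (\<lambda>\<omega>. X h \<omega> - X 0 \<omega>)"
    using levy s h unfolding levy_process_def by fastforce
  also have "\<dots> = distr (P x) borel (\<lambda>\<omega>. X h \<omega> - x)"
    using X0 h by (intro distr_cong_AE) auto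
  also have "\<dots> = distr (distr (P x) lborel (X h)) borel (\<lambda>y. y - x)"
    using h by (subst distr_distr) (auto simp: o_def)
  also have "\<dots> = distr (density lborel (\<lambda>y. ennreal (p h (x - y)))) borel (\<lambda>y. y - x)"
    using distributed_distr_eq_density[OF dist[OF h]] by simp
  also have "\<dots> = density lborel (\<lambda>z. ennreal (p h (- z)))"
  proof (rule measure_eqI)
    fix A assume "A \<in> sets (distr (density lborel (\<lambda>y. ennreal (p h (x - y)))) borel (\<lambda>y. y - x))"
    then have [measurable]: "A \<in> sets borel" by simp
    have [measurable]: "(\<lambda>y. y - x) -` A \<in> sets borel"
      using measurable_sets[of "\<lambda>y. y - x" borel borel A] by simp
    have "emeasure (distr (density lborel (\<lambda>y. ennreal (p h (x - y)))) borel (\<lambda>y. y - x)) A =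
        (\<integral>\<^sup>+ y. ennreal (p h (x - y)) * indicator A (y - x) \<partial>lborel)"
      by (subst emeasure_distr, simp, simp, subst emeasure_density)
        (auto intro!: nn_integral_cong simp: indicator_def)
    also have "\<dots> = (\<integral>\<^sup>+ z. ennreal (p h (x - (x + z))) * indicator A (x + z - x) \<partial>lborel)"
      by (rule nn_integral_lborel_shift[symmetric]) measurable
    also have "\<dots> = emeasure (density lborel (\<lambda>z. ennreal (p h (- z)))) A"
      by (subst emeasure_density) auto
    finally show "emeasure (distr (density lborel (\<lambda>y. ennreal (p h (x - y)))) borel (\<lambda>y. y - x)) A =
        emeasure (density lborel (\<lambda>z. ennreal (p h (- z)))) A" .
  qed simp
  also have "\<dots> = density lborel (\<lambda>z. ennreal (stable_kernel \<alpha> h z))" by (rule unique(2))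
  finally show "distr (P x) borel (\<lambda>\<omega>. X (s + h) \<omega> - X s \<omega>) = density lborel (\<lambda>z. ennreal (stable_kernel \<alpha> h z))" .
qed

lemma stable_kernel_bounded:
  assumes "0 < \<alpha>" "0 < t"
  shows "\<bar>stable_kernel \<alpha> t (x::real^'n::finite)\<bar> \<le>
    (\<integral>\<xi>. exp (- t * norm \<xi> powr \<alpha>) \<partial>(lborel :: (real^'n) measure)) / (2 * pi) ^ CARD('n)"
  using fourier_kernel_bounded[OF integrable_stretched_exp[OF assms], of x] unfolding stable_kernel_def by simp

proposition stable_process_survival:
  fixes X :: "real \<Rightarrow> 'w \<Rightarrow> real^'n::finite"
  assumes \<alpha>: "0 < \<alpha>" and X: "symmetric_stable_process \<alpha> P X"
    and s0: "s 0 = 0" and s_mono: "\<And>k. s k < s (Suc k)"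
    and Q[measurable]: "Q \<in> sets borel" and bQ: "bounded Q" and n: "0 < n"
  shows "measure (P x) {\<omega> \<in> space (P x). \<forall>k<n. X (s (Suc k)) \<omega> \<in> Q} =
    survival Q (\<lambda>k. stable_kernel \<alpha> (s (Suc k) - s k)) 0 n x"
proof -
  let ?K = "\<lambda>k. stable_kernel \<alpha> (s (Suc k) - s k) :: real^'n \<Rightarrow> real"
  let ?N = "\<lambda>k. density lborel (\<lambda>z. ennreal (?K k z))"
  let ?Z = "\<lambda>k \<omega>. X (s (Suc k)) \<omega> - X (s k) \<omega>"
  have levy: "levy_process (P x) X" and X0: "AE \<omega> in P x. X 0 \<omega> = x"
    using X unfolding symmetric_stable_process_def by blast+
  interpret prob_space "P x" using levy unfolding levy_process_def by blast
  have s_nonneg: "0 \<le> s k" for k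
    by (induction k) (use s0 s_mono in \<open>auto intro: less_imp_le order_trans\<close>)
  have Xm[measurable]: "X (s k) \<in> borel_measurable (P x)" for k
    using levy s_nonneg unfolding levy_process_def by blast
  have Z_distr: "distr (P x) borel (?Z k) = ?N k" for k
    using stable_process_increment(1)[OF \<alpha> X s_nonneg, of "s (Suc k) - s k" x k] s_mono by simp
  have prob: "prob_space (?N k)" for k
    unfolding Z_distr[symmetric] by (rule prob_space_distr) measurable
  have indep: "indep_vars (\<lambda>_. borel) ?Z {..<n}"
    using levy s0 s_mono unfolding levy_process_def by simp
  have joint: "distr (P x) (\<Pi>\<^sub>M k\<in>{..<n}. borel) (\<lambda>\<omega>. \<lambda>k\<in>{..<n}. ?Z k \<omega>) = (\<Pi>\<^sub>M k\<in>{..<n}. ?N k)"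
    using indep_vars_iff_distr_eq_PiM'[where I = "{..<n}" and M' = "\<lambda>_. borel" and X = ?Z] indep n by (simp add: Z_distr lessThan_empty_iff)
  let ?A = "{z\<in>space (\<Pi>\<^sub>M k\<in>{..<n}. borel). \<forall>k\<in>{..<n}. x + (\<Sum>i\<in>{0..k}. z i) \<in> Q}"
  have A[measurable]: "?A \<in> sets (\<Pi>\<^sub>M k\<in>{..<n}. (borel :: (real^'n) measure))"
    by measurable
  have surv: "emeasure (\<Pi>\<^sub>M k\<in>{0..<0+n}. ?N k) {z\<in>space (\<Pi>\<^sub>M k\<in>{0..<0+n}. borel). \<forall>k\<in>{0..<0+n}. x + (\<Sum>i\<in>{0..k}. z i) \<in> Q} =
      ennreal (survival Q ?K 0 n x)" "0 \<le> survival Q ?K 0 n x"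
  proof -
    have even: "?K k (- z) = ?K k z" for k z
      unfolding stable_kernel_def by (rule fourier_kernel_uminus)
    have nonneg: "0 \<le> ?K k z" for k z
      by (rule stable_process_increment(2)[OF \<alpha> X order_refl]) (simp add: s_mono)
    have bd: "?K k z \<le> (\<integral>\<xi>. exp (- (s (Suc k) - s k) * norm \<xi> powr \<alpha>) \<partial>(lborel :: (real^'n) measure)) / (2 * pi) ^ CARD('n)" for k z
      using stable_kernel_bounded[OF \<alpha>, of "s (Suc k) - s k" z] s_mono[of k] by simp
    show "emeasure (\<Pi>\<^sub>M k\<in>{0..<0+n}. ?N k) {z\<in>space (\<Pi>\<^sub>M k\<in>{0..<0+n}. borel). \<forall>k\<in>{0..<0+n}. x + (\<Sum>i\<in>{0..k}. z i) \<in> Q} =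
      ennreal (survival Q ?K 0 n x)" "0 \<le> survival Q ?K 0 n x"
      using survival_eq_emeasure[where K = ?K, OF stable_kernel_measurable nonneg even bd prob Q bQ, where m = 0 and j = n] by blast+
  qed
  have tele: "X (s (Suc k)) \<omega> = X 0 \<omega> + (\<Sum>i\<in>{0..k}. ?Z i \<omega>)" for k \<omega>
    by (induction k) (simp_all add: s0)
  have "emeasure (P x) {\<omega> \<in> space (P x). \<forall>k<n. X (s (Suc k)) \<omega> \<in> Q} =
      emeasure (P x) ((\<lambda>\<omega>. \<lambda>k\<in>{..<n}. ?Z k \<omega>) -` ?A \<inter> space (P x))"
  proof (rule emeasure_eq_AE)
    show "AE \<omega> in P x. (\<omega> \<in> {\<omega> \<in> space (P x). \<forall>k<n. X (s (Suc k)) \<omega> \<in> Q}) =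
        (\<omega> \<in> (\<lambda>\<omega>. \<lambda>k\<in>{..<n}. ?Z k \<omega>) -` ?A \<inter> space (P x))"
      using X0
    proof eventually_elim
      case (elim \<omega>)
      have "(\<Sum>i\<in>{0..k}. (\<lambda>k\<in>{..<n}. ?Z k \<omega>) i) = (\<Sum>i\<in>{0..k}. ?Z i \<omega>)" if "k < n" for k
        using that by (intro sum.cong) auto
      then have walk: "X (s (Suc k)) \<omega> = x + (\<Sum>i\<in>{0..k}. (\<lambda>k\<in>{..<n}. ?Z k \<omega>) i)" if "k < n" for k
        using that by (simp only: tele[of k \<omega>] elim)
      have "(\<forall>k<n. X (s (Suc k)) \<omega> \<in> Q) \<longleftrightarrow>
          (\<forall>k\<in>{..<n}. x + (\<Sum>i\<in>{0..k}. (\<lambda>k\<in>{..<n}. ?Z k \<omega>) i) \<in> Q)"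
        unfolding Ball_def lessThan_iff by (intro all_cong arg_cong[of _ _ "\<lambda>w. w \<in> Q"] walk)
      then show ?case by (simp add: space_PiM conj_commute del: restrict_apply)
    qed
    show "(\<lambda>\<omega>. \<lambda>k\<in>{..<n}. ?Z k \<omega>) -` ?A \<inter> space (P x) \<in> events"
      by (rule measurable_sets[OF _ A]) measurable
  qed measurable
  also have "\<dots> = emeasure (\<Pi>\<^sub>M k\<in>{..<n}. ?N k) ?A"
    unfolding joint[symmetric] by (subst emeasure_distr) auto
  also have "\<dots> = ennreal (survival Q ?K 0 n x)"
    using surv by (simp add: atLeast0LessThan)
  finally show ?thesis
    using surv unfolding measure_def by simp
qed

section \<open>Differentiability\<close>

lemma has_real_derivative_integral:
  fixes f f' :: "real \<Rightarrow> 'a \<Rightarrow> real"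
  assumes deriv: "\<And>s y. ((\<lambda>s. f s y) has_real_derivative f' s y) (at s)"
    and bound: "\<And>s y. \<bar>f' s y\<bar> \<le> w y" and w: "integrable M w"
    and int: "\<And>s. integrable M (f s)" and meas: "f' s \<in> borel_measurable M"
  shows "((\<lambda>s. \<integral>y. f s y \<partial>M) has_real_derivative (\<integral>y. f' s y \<partial>M)) (at s)"
  unfolding DERIV_def tendsto_at_iff_sequentially comp_def
proof (intro allI impI)
  fix u :: "nat \<Rightarrow> real" assume u: "\<forall>k. u k \<in> UNIV - {0}" and u0: "u \<longlonglongrightarrow> 0"
  have [measurable]: "f s \<in> borel_measurable M" for s using int by (rule borel_measurable_integrable)
  have "(\<lambda>k. \<integral>y. (f (s + u k) y - f s y) / u k \<partial>M) \<longlonglongrightarrow> (\<integral>y. f' s y \<partial>M)"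
  proof (rule integral_dominated_convergence[OF meas _ w])
    show "AE y in M. (\<lambda>k. (f (s + u k) y - f s y) / u k) \<longlonglongrightarrow> f' s y"
      using deriv[of _ s] u u0 unfolding DERIV_def tendsto_at_iff_sequentially comp_def by blast
    show "AE y in M. norm ((f (s + u k) y - f s y) / u k) \<le> w y" for k
    proof (rule AE_I2)
      fix y
      have "norm (f (s + u k) y - f s y) \<le> w y * norm (s + u k - s)"
        by (rule field_differentiable_bound[where S = UNIV and f' = "\<lambda>s. f' s y"])
          (use deriv bound in auto)
      then show "norm ((f (s + u k) y - f s y) / u k) \<le> w y"
        using u by (simp add: divide_simps)
    qed
  qed measurable
  moreover have "(\<integral>y. (f (s + u k) y - f s y) / u k \<partial>M) = ((\<integral>y. f (s + u k) y \<partial>M) - (\<integral>y. f s y \<partial>M)) / u k" for k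
    using int by simp
  ultimately show "(\<lambda>k. ((\<integral>y. f (s + u k) y \<partial>M) - (\<integral>y. f s y \<partial>M)) / u k) \<longlonglongrightarrow> (\<integral>y. f' s y \<partial>M)"
    by (simp only:)
qed

text \<open>Differentiation of the Fourier integral produces the factor \<open>\<xi> \<bullet> v\<close>, which the decay of the integrand absorbs uniformly
in the argument.\<close>

lemma stable_kernel_directional_derivative:
  fixes v :: "real^'n::finite"
  assumes "0 < \<alpha>" "0 < t"
  obtains K' :: "real^'n \<Rightarrow> real" and C where "K' \<in> borel_measurable borel" "\<And>z. \<bar>K' z\<bar> \<le> C"
    "\<And>z s. ((\<lambda>s. stable_kernel \<alpha> t (z + s *\<^sub>R v)) has_real_derivative K' (z + s *\<^sub>R v)) (at s)"
proof -
  let ?e = "\<lambda>\<xi>::real^'n. exp (- t * norm \<xi> powr \<alpha>)"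
  let ?w = "\<lambda>\<xi>::real^'n. norm v * ((1 + norm \<xi>) * ?e \<xi>)"
  define K' where "K' z = (\<integral>\<xi>. - sin (\<xi> \<bullet> z) * (\<xi> \<bullet> v) * ?e \<xi> \<partial>lborel) / (2 * pi) ^ CARD('n)" for z
  have w: "integrable lborel ?w" by (intro integrable_mult_right integrable_moment_stretched_exp assms)
  have bound: "\<bar>- sin (\<xi> \<bullet> z) * (\<xi> \<bullet> v) * ?e \<xi>\<bar> \<le> ?w \<xi>" for \<xi> z
  proof -
    have "\<bar>sin (\<xi> \<bullet> z)\<bar> * \<bar>\<xi> \<bullet> v\<bar> \<le> 1 * (norm \<xi> * norm v)"
      by (intro mult_mono Cauchy_Schwarz_ineq2) auto
    also have "\<dots> \<le> norm v * (1 + norm \<xi>)" by (simp add: algebra_simps)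
    finally have "\<bar>sin (\<xi> \<bullet> z)\<bar> * \<bar>\<xi> \<bullet> v\<bar> * ?e \<xi> \<le> norm v * (1 + norm \<xi>) * ?e \<xi>"
      by (intro mult_right_mono) auto
    then show ?thesis by (simp add: abs_mult mult.assoc)
  qed
  have int: "integrable lborel (\<lambda>\<xi>. - sin (\<xi> \<bullet> z) * (\<xi> \<bullet> v) * ?e \<xi>)" for z
    by (rule Bochner_Integration.integrable_bound[OF w], measurable)
      (use bound in \<open>auto intro: order_trans\<close>)
  have "K' \<in> borel_measurable borel" unfolding K'_def[abs_def] by measurable
  moreover have "\<bar>K' z\<bar> \<le> (\<integral>\<xi>. ?w \<xi> \<partial>lborel) / (2 * pi) ^ CARD('n)" for z
  proof -
    have "\<bar>\<integral>\<xi>. - sin (\<xi> \<bullet> z) * (\<xi> \<bullet> v) * ?e \<xi> \<partial>lborel\<bar> \<le> (\<integral>\<xi>. \<bar>- sin (\<xi> \<bullet> z) * (\<xi> \<bullet> v) * ?e \<xi>\<bar> \<partial>lborel)"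
      by (rule integral_abs_bound)
    also have "\<dots> \<le> (\<integral>\<xi>. ?w \<xi> \<partial>lborel)"
      by (rule integral_mono[OF integrable_abs[OF int] w bound])
    finally show ?thesis unfolding K'_def by (simp add: abs_divide divide_right_mono)
  qed
  moreover have "((\<lambda>s. stable_kernel \<alpha> t (z + s *\<^sub>R v)) has_real_derivative K' (z + s *\<^sub>R v)) (at s)" for z s
    unfolding stable_kernel_def fourier_kernel_def K'_def
  proof (intro DERIV_cdivide has_real_derivative_integral[OF _ _ w])
    show "((\<lambda>s. cos (\<xi> \<bullet> (z + s *\<^sub>R v)) * ?e \<xi>) has_real_derivative
        - sin (\<xi> \<bullet> (z + s *\<^sub>R v)) * (\<xi> \<bullet> v) * ?e \<xi>) (at s)" for s \<xi>
      unfolding inner_add_right inner_scaleR_right by (auto intro!: derivative_eq_intros)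
    show "integrable lborel (\<lambda>\<xi>. cos (\<xi> \<bullet> (z + s *\<^sub>R v)) * ?e \<xi>)" for s
      by (rule integrable_cos_mult[OF integrable_stretched_exp[OF assms]])
  qed (use bound in auto)
  ultimately show ?thesis by (rule that)
qed

proposition killed_stable_step_differentiable:
  fixes F :: "real^'n::finite \<Rightarrow> real"
  assumes \<alpha>: "0 < \<alpha>" and t: "0 < t" and [measurable]: "F \<in> borel_measurable borel" "Q \<in> sets borel"
    and Q: "bounded Q" and F: "\<And>y. y \<in> Q \<Longrightarrow> \<bar>F y\<bar> \<le> B"
  shows "\<exists>D. ((\<lambda>s. killed_step Q (stable_kernel \<alpha> t) F (x + s *\<^sub>R v)) has_real_derivative D) (at s)"
proof -
  obtain K' :: "real^'n \<Rightarrow> real" and C where [measurable]: "K' \<in> borel_measurable borel"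
    and C: "\<And>z. \<bar>K' z\<bar> \<le> C"
    and deriv: "\<And>z s. ((\<lambda>s. stable_kernel \<alpha> t (z + s *\<^sub>R v)) has_real_derivative K' (z + s *\<^sub>R v)) (at s)"
    using stable_kernel_directional_derivative[OF \<alpha> t, of v] by blast
  have shift: "x + s *\<^sub>R v - y = (x - y) + s *\<^sub>R v" for s y by simp
  have "((\<lambda>s. \<integral>y. indicator Q y * (stable_kernel \<alpha> t (x + s *\<^sub>R v - y) * F y) \<partial>lborel) has_real_derivative
      (\<integral>y. indicator Q y * (K' (x + s *\<^sub>R v - y) * F y) \<partial>lborel)) (at s)"
  proof (rule has_real_derivative_integral)
    show "((\<lambda>s. indicator Q y * (stable_kernel \<alpha> t (x + s *\<^sub>R v - y) * F y)) has_real_derivative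
        indicator Q y * (K' (x + s *\<^sub>R v - y) * F y)) (at s)" for s y
      unfolding shift by (intro DERIV_cmult DERIV_cmult_right deriv)
    show "\<bar>indicator Q y * (K' (x + s *\<^sub>R v - y) * F y)\<bar> \<le> indicator Q y * (C * B)" for s y
    proof (cases "y \<in> Q")
      case True
      have "\<bar>K' (x + s *\<^sub>R v - y)\<bar> * \<bar>F y\<bar> \<le> C * B"
        using C F[OF True] by (intro mult_mono) (auto intro: order_trans[OF abs_ge_zero])
      then show ?thesis using True by (simp add: abs_mult)
    qed simp
    show "integrable lborel (\<lambda>y. indicator Q y * (C * B))"
      using emeasure_bounded_finite[OF Q] by (intro integrable_mult_left integrable_real_indicator) auto
    show "integrable lborel (\<lambda>y. indicator Q y * (stable_kernel \<alpha> t (x + s *\<^sub>R v - y) * F y))" for s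
      by (rule integrable_killed_step[OF _ _ _ Q stable_kernel_bounded[OF \<alpha> t] F]) auto
  qed measurable
  then show ?thesis unfolding killed_step_def by blast
qed

section \<open>Segments parallel to the axes\<close>

lemma set_coord_eq: "set_coord x i s = x + (s - x $ i) *\<^sub>R axis i 1"
  by (simp add: vec_eq_iff set_coord_nth axis_def)

lemma set_coord_self: "set_coord x i (x $ i) = x"
  by (simp add: vec_eq_iff set_coord_nth)

lemma set_coord_combination:
  "u + v = 1 \<Longrightarrow> u *\<^sub>R set_coord x i b + v *\<^sub>R set_coord x i c = set_coord x i (u * b + v * c)"
  by (auto simp: vec_eq_iff set_coord_nth simp flip: distrib_right)

lemma coord_symmetric_convex_domain_box:
  assumes "\<And>i. 0 < a $ i"
  shows "coord_symmetric_convex_domain (box (- a) a)"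
  unfolding coord_symmetric_convex_domain_def
proof (intro conjI allI ballI)
  have "0 \<in> box (- a) a" using assms by (simp add: mem_box_cart)
  then show "box (- a) a \<noteq> {}" by blast
  show "set_coord x i (- x $ i) \<in> box (- a) a" if "x \<in> box (- a) a" for i x
    using that by (auto simp: mem_box_cart set_coord_nth)
      (metis minus_less_iff)+
qed (auto simp: open_box convex_box)

lemma concave_on_coordinate_segment:
  assumes "concave_on {b..c} (\<lambda>u. F (set_coord q i u))" "b \<le> c"
  shows "concave_on (closed_segment (set_coord q i b) (set_coord q i c)) F"
  unfolding concave_on_iff
proof (intro conjI ballI allI impI)
  have param: "\<exists>u\<in>{b..c}. x = set_coord q i u" if x: "x \<in> closed_segment (set_coord q i b) (set_coord q i c)" for x
  proof -
    obtain u where u: "0 \<le> u" "u \<le> 1" "x = (1 - u) *\<^sub>R set_coord q i b + u *\<^sub>R set_coord q i c"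
      using x by (auto simp: in_segment)
    have "x = set_coord q i ((1 - u) * b + u * c)" unfolding u(3) by (rule set_coord_combination) simp
    moreover have "(1 - u) * b + u * c \<in> {b..c}"
      using convex_bound_le[of b c c "1 - u" u] convex_bound_le[of "- b" "- b" "- c" "1 - u" u] u assms(2)
      by (auto simp: algebra_simps)
    ultimately show ?thesis by blast
  qed
  fix x y and u v :: real
  assume xy: "x \<in> closed_segment (set_coord q i b) (set_coord q i c)" "y \<in> closed_segment (set_coord q i b) (set_coord q i c)"
    and uv: "0 \<le> u" "0 \<le> v" "u + v = 1"
  obtain r s where rs: "r \<in> {b..c}" "s \<in> {b..c}" "x = set_coord q i r" "y = set_coord q i s"
    using param xy by metis
  have "u * F (set_coord q i r) + v * F (set_coord q i s) \<le> F (set_coord q i (u *\<^sub>R r + v *\<^sub>R s))"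
    using assms(1) rs(1,2) uv unfolding concave_on_iff by blast
  then show "u * F x + v * F y \<le> F (u *\<^sub>R x + v *\<^sub>R y)"
    unfolding rs set_coord_combination[OF uv(3)] by simp
qed simp

text \<open>For the box, a segment that meets the frontier only in its end points must end on the face with \<open>q $ i = a $ i\<close>: its midpoint is
an interior point, so none of the other coordinates of \<open>q\<close> touches a face.\<close>

lemma mid_concave_mid_cone:
  fixes a :: "real^'n::finite"
  assumes a: "\<And>i. 0 < a $ i" and F: "mid_cone a F"
  shows "mid_concave (box (- a) a) F"
  unfolding mid_concave_def mid_concave_along_def
proof (intro conjI allI impI coord_symmetric_convex_domain_box a, elim conjE)
  fix i and q :: "real^'n"
  let ?Q = "box (- a) a"
  assume q: "0 < q $ i" and seg: "open_segment (set_coord q i (- q $ i)) q \<subseteq> ?Q"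
    and fr: "closed_segment (set_coord q i (- q $ i)) q \<inter> frontier ?Q = {set_coord q i (- q $ i), q}"
  have "set_coord q i 0 \<in> open_segment (set_coord q i (- q $ i)) q"
  proof -
    have "set_coord q i 0 = (1 - 1/2) *\<^sub>R set_coord q i (- q $ i) + (1/2) *\<^sub>R q"
      using set_coord_combination[of "1 - 1/2" "1/2" q i "- q $ i" "q $ i"] by (simp add: set_coord_self)
    moreover have "set_coord q i (- q $ i) \<noteq> q"
      using q by (auto simp: vec_eq_iff set_coord_nth)
    ultimately show ?thesis unfolding in_segment
      by (intro conjI exI[of _ "1/2"]) auto
  qed
  then have mid: "set_coord q i 0 \<in> ?Q" using seg by blast
  have "q \<in> frontier ?Q" using fr by blast
  then have "q \<in> closure ?Q" "q \<notin> ?Q" by (auto simp: frontier_def interior_open[OF open_box])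
  then have "q \<in> cbox (- a) a" "q \<notin> ?Q" using closure_mono[OF box_subset_cbox[of "- a" a]] by auto
  moreover have "- a $ j < q $ j \<and> q $ j < a $ j" if "j \<noteq> i" for j
    using mid that unfolding mem_box_cart set_coord_nth by (auto dest: spec[of _ j])
  ultimately have "\<not> q $ i < a $ i" "q $ i \<le> a $ i"
    using q a[of i] unfolding mem_box_cart by (force, blast)
  then have "q $ i = a $ i" by simp
  moreover have "concave_on {-(a $ i / 2)..a $ i / 2} (\<lambda>u. F (set_coord (set_coord q i 0) i u))"
    by (rule mid_cone_concave[OF F mid])
  moreover have "set_coord (set_coord q i 0) i u = set_coord q i u" for u
    by (simp add: vec_eq_iff set_coord_nth)
  ultimately show "concave_on (closed_segment (set_coord q i (- q $ i / 2)) (set_coord q i (q $ i / 2))) F"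
    using a[of i] by (intro concave_on_coordinate_segment) auto
qed

lemma mid_cone_derivative_sign:
  fixes a :: "real^'n::finite"
  assumes F: "mid_cone a F" and x: "x \<in> box (- a) a"
    and D: "((\<lambda>s. F (set_coord x i s)) has_real_derivative D) (at (x $ i))"
  shows "x $ i < 0 \<Longrightarrow> 0 \<le> D" and "0 < x $ i \<Longrightarrow> D \<le> 0"
proof -
  have xi: "- (a $ i) < x $ i" "x $ i < a $ i" using x by (auto simp: mem_box_cart)
  show "0 \<le> D" if "x $ i < 0"
  proof (rule mono_on_imp_deriv_nonneg[OF _ D])
    show "mono_on {- (a $ i)<..<0} (\<lambda>s. F (set_coord x i s))"
      by (rule mono_onI) (intro mid_cone_antimono[OF F x]; auto)
    show "x $ i \<in> interior {- (a $ i)<..<0}" using xi that by (simp add: interior_open)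
  qed
  show "D \<le> 0" if "0 < x $ i"
  proof -
    have "0 \<le> - D"
    proof (rule mono_on_imp_deriv_nonneg[OF _ DERIV_minus[OF D]])
      show "mono_on {0<..<a $ i} (\<lambda>s. - F (set_coord x i s))"
        by (rule mono_onI, rule le_imp_neg_le) (intro mid_cone_antimono[OF F x]; auto)
      show "x $ i \<in> interior {0<..<a $ i}" using xi that by (simp add: interior_open)
    qed
    then show ?thesis by simp
  qed
qed

lemma mid_cone_survival:
  assumes "0 < \<alpha>" "\<alpha> \<le> 2" "\<And>k. 0 < h k" "\<And>i. 0 < a $ i"
  shows "mid_cone a (survival (box (- a) a) (\<lambda>k. stable_kernel \<alpha> (h k)) m j)"
proof (induction j arbitrary: m)
  case 0
  have "survival (box (- a) a) (\<lambda>k. stable_kernel \<alpha> (h k)) m 0 = (\<lambda>_. 1)" by auto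
  then show ?case by (simp add: mid_cone_const_1)
next
  case (Suc j)
  have "survival (box (- a) a) (\<lambda>k. stable_kernel \<alpha> (h k)) m (Suc j) =
      killed_step (box (- a) a) (stable_kernel \<alpha> (h m)) (survival (box (- a) a) (\<lambda>k. stable_kernel \<alpha> (h k)) (Suc m) j)"
    by auto
  then show ?case using mid_cone_stable_step[OF assms(1,2) assms(3) assms(4) Suc.IH] by simp
qed

section \<open>Mid-concavity of the survival probability\<close>

theorem theorem1p2:
  fixes \<alpha> :: real and a :: "real^'n::finite"
    and P :: "real^'n \<Rightarrow> 'w measure" and X :: "real \<Rightarrow> 'w \<Rightarrow> real^'n"
    and n :: nat and t :: "nat \<Rightarrow> real"
    and Q :: "(real^'n) set" and F :: "real^'n \<Rightarrow> real"
  assumes a_pos: "\<And>i. 0 < a $ i"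
    and Q_eq: "Q = {x. \<forall>i. - a $ i < x $ i \<and> x $ i < a $ i}"
    and alpha: "0 < \<alpha>" "\<alpha> \<le> 2"
    and process: "symmetric_stable_process \<alpha> P X"
    and n_pos: "1 \<le> n"
    and t_pos: "0 < t 1"
    and t_mono: "strict_mono_on {1..n} t"
    and F_eq: "\<And>x. F x = measure (P x) {\<omega> \<in> space (P x). \<forall>k\<in>{1..n}. X (t k) \<omega> \<in> Q}"
  shows "mid_concave Q F \<and>
    (\<forall>x\<in>Q. \<forall>i.
       (x $ i < 0 \<longrightarrow>
          (\<exists>D\<ge>0. ((\<lambda>s. F (set_coord x i s)) has_real_derivative D) (at (x $ i)))) \<and>
       (x $ i > 0 \<longrightarrow>
          (\<exists>D\<le>0. ((\<lambda>s. F (set_coord x i s)) has_real_derivative D) (at (x $ i)))))"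
proof -
  have Q: "Q = box (- a) a" unfolding Q_eq by (auto simp: mem_box_cart)
  \<comment> \<open>The times, preceded by 0 and continued beyond \<open>t n\<close> so that all steps have positive length.\<close>
  define s where "s k = (if k = 0 then 0 else if k \<le> n then t k else t n + real (k - n))" for k
  have s0: "s 0 = 0" unfolding s_def by simp
  have s_mono: "s k < s (Suc k)" for k
  proof -
    consider "k = 0" | "0 < k" "Suc k \<le> n" | "k = n" "0 < k" | "n < k" by linarith
    then show ?thesis
    proof cases
      case 2
      then have "t k < t (Suc k)" by (intro strict_mono_onD[OF t_mono]) auto
      then show ?thesis using 2 by (simp add: s_def)
    qed (use t_pos n_pos in \<open>auto simp: s_def\<close>)
  qed
  define h where "h k = s (Suc k) - s k" for k
  have h: "0 < h k" for k unfolding h_def using s_mono by simp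
  let ?S = "survival (box (- a) a) (\<lambda>k. stable_kernel \<alpha> (h k)) :: nat \<Rightarrow> nat \<Rightarrow> real^'n \<Rightarrow> real"
  have F: "F = ?S 0 n"
  proof
    fix x
    have "(\<forall>k\<in>{1..n}. X (t k) \<omega> \<in> Q) \<longleftrightarrow> (\<forall>k<n. X (s (Suc k)) \<omega> \<in> Q)" for \<omega>
    proof -
      have "{1..n} = Suc ` {..<n}" by (simp add: lessThan_atLeast0 image_Suc_atLeastLessThan atLeastLessThanSuc_atLeastAtMost)
      then show ?thesis by (auto simp: s_def)
    qed
    then show "F x = ?S 0 n x"
      unfolding F_eq h_def
      using stable_process_survival[OF alpha(1) process s0 s_mono, of Q n x] n_pos by (simp add: Q)
  qed
  have cone: "mid_cone a (?S m j)" for m j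
    by (rule mid_cone_survival[OF alpha h a_pos])
  have diff: "\<exists>D. ((\<lambda>s. F (set_coord x i s)) has_real_derivative D) (at (x $ i))" for x i
  proof -
    obtain j where n: "n = Suc j" using n_pos by (cases n) auto
    obtain B where B: "\<And>y. y \<in> box (- a) a \<Longrightarrow> \<bar>?S (Suc 0) j y\<bar> \<le> B"
      using mid_cone_bounded[OF cone] by blast
    have "\<exists>D. ((\<lambda>u. killed_step (box (- a) a) (stable_kernel \<alpha> (h 0)) (?S (Suc 0) j) ((x - x $ i *\<^sub>R axis i 1) + u *\<^sub>R axis i 1))
        has_real_derivative D) (at (x $ i))"
      by (rule killed_stable_step_differentiable[OF alpha(1) h mid_cone_measurable[OF cone] _ bounded_box B]) auto
    moreover have "set_coord x i u = (x - x $ i *\<^sub>R axis i 1) + u *\<^sub>R axis i 1" for u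
      unfolding set_coord_eq by (simp add: algebra_simps)
    ultimately show ?thesis unfolding F n by auto
  qed
  have F_cone: "mid_cone a F" unfolding F by (rule cone)
  have "mid_concave Q F" unfolding Q by (rule mid_concave_mid_cone[OF a_pos F_cone])
  moreover have "(x $ i < 0 \<longrightarrow> (\<exists>D\<ge>0. ((\<lambda>s. F (set_coord x i s)) has_real_derivative D) (at (x $ i)))) \<and>
      (x $ i > 0 \<longrightarrow> (\<exists>D\<le>0. ((\<lambda>s. F (set_coord x i s)) has_real_derivative D) (at (x $ i))))"
    if "x \<in> Q" for x i
    using diff[of x i] mid_cone_derivative_sign[OF F_cone, of x] that unfolding Q by blast
  ultimately show ?thesis by blast
qed

end
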